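(* Let $G=(V,E)$ be a simple undirected graph and let $\mathcal{H}=\{H_v\}_{v\in V}$ be a collection of non-trivial finite groups. Then there exists an exact sequence of groups $$1\to\prod_{v\in V}\operatorname{Aut}_{\mathrm{Groups}}(H_v)\to\operatorname{Aut}_{\mathrm{Part}}\big(\mathbb{M}(G,\mathcal{H})\big)\to\operatorname{Aut}_{\mathrm{Graphs}}(G).$$
   Context: Graphs: $\mathrm{Graphs}$ is the category of simple undirected graphs $G=(V,E)$ (possibly infinite) and graph homomorphisms; $\operatorname{Aut}_{\mathrm{Graphs}}(G)$ is the group of graph automorphisms. $\operatorname{Aut}_{\mathrm{Groups}}(H)$ is the automorphism group of a group $H$. A clique of $G$ is a (possibly infinite) subset $C\subseteq V$ of pairwise adjacent vertices. Partial groups: for a set $X$, $\mathbb{W}(X)$ is the free monoid of words on $X$, $\circ$ is concatenation, $\emptyset$ the empty word, and $X$ is identified with the words of length 1. A partial group is a tuple $\mathbb{M}=(\mathcal{M},\mathbb{D},\Pi,(-)^{-1})$ where $\mathcal{M}$ is a non-empty set; $\mathbb{D}\subseteq\mathbb{W}(\mathcal{M})$ satisfies $\mathcal{M}\subseteq\mathbb{D}$ and ($u\circ v\in\mathbb{D}\Rightarrow u,v\in\mathbb{D}$); $\Pi\colon\mathbb{D}\to\mathcal{M}$ restricts to the identity on $\mathcal{M}$ and if $u\circ v\circ w\in\mathbb{D}$ then $u\circ\Pi(v)\circ w\in\mathbb{D}$ and $\Pi(u\circ v\circ w)=\Pi(u\circ\Pi(v)\circ w)$; $x\mapsto x^{-1}$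 is an involutory bijection of $\mathcal{M}$, extended to words by $(x_1,\dots,x_n)^{-1}=(x_n^{-1},\dots,x_1^{-1})$, such that if $u\in\mathbb{D}$ then $u^{-1}\circ u\in\mathbb{D}$ and $\Pi(u^{-1}\circ u)=1:=\Pi(\emptyset)$. A homomorphism of partial groups is a map $\varphi\colon\mathcal{M}_1\to\mathcal{M}_2$ whose letterwise extension $\overline{\varphi}$ satisfies $\overline{\varphi}(\mathbb{D}_1)\subseteq\mathbb{D}_2$ and $\Pi_2(\overline{\varphi}(u))=\varphi(\Pi_1(u))$ for $u\in\mathbb{D}_1$; isomorphisms are bijective homomorphisms whose inverse is a homomorphism. $\mathrm{Part}$ is the resulting category and $\operatorname{Aut}_{\mathrm{Part}}(\mathbb{M})$ the automorphism group of $\mathbb{M}$ in it. The partial group $\mathbb{M}(G,\mathcal{H})$: let $G=(V,E)$ be a simple undirected graph and $\mathcal{H}=\{H_v\}_{v\in V}$ a collection of groups. Put $H_v^*=H_v\smallsetminus\{1\}$ (regarded as disjoint sets for different $v$). A word $(g_1,\dots,g_r)\in\mathbb{W}(\bigcup_{v}H_v^* )$ is reduced if consecutive letters lie in different groups $H_v$ (the empty word is reduced), and cyclically reduced if all its cyclic permutations are reduced (the empty word and words of length 1 are cyclically reduced). $\Pi(w)$ denotes the unique reduced form of a word $w$, i.e. the element of the free product it represents. For a clique $C$ let $\mathbb{M}(C)=(\operatorname{CR}(C),\mathbb{D}(C),\Pi(C),(-)_C^{-1})$, where $\operatorname{CR}(C)$ is the set of cyclically reduced words in $\mathbb{W}(\bigcup_{v\in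 C}H_v^* )$; $\mathbb{D}(C)$ is the set of words $(u_1,\dots,u_n)\in\mathbb{W}(\operatorname{CR}(C))$ such that $\Pi(u_i\circ u_{i+1}\circ\cdots\circ u_j)\in\operatorname{CR}(C)$ for all $1\le i\le j\le n$; $\Pi(C)(u_1,\dots,u_n)=\Pi(u_1\circ\cdots\circ u_n)$; and $(-)_C^{-1}$ is inversion in the free product $\ast_{v\in C}H_v$. Each $\mathbb{M}(C)$ is a partial group, and $\mathbb{M}(G,\mathcal{H})=(\mathcal{M}(G,\mathcal{H}),\mathbb{D}(G,\mathcal{H}),\Pi(G,\mathcal{H}),(-)^{-1})$ is the colimit in $\mathrm{Part}$ of the $\mathbb{M}(C)$ over the poset of cliques $C$ of $G$ ordered by inclusion (with the inclusion maps). It is identified concretely with $\mathcal{M}(G,\mathcal{H})=\bigcup_C\operatorname{CR}(C)$, $\mathbb{D}(G,\mathcal{H})=\bigcup_C\mathbb{D}(C)$, with product and inversion those of the $\mathbb{M}(C)$. *)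

theory Defs
  imports "HOL-Algebra.Algebra"
begin

definition simple_graph :: "'v set \<Rightarrow> 'v set set \<Rightarrow> bool" where
  "simple_graph V E \<longleftrightarrow> (\<forall>e\<in>E. e \<subseteq> V \<and> card e = 2)"

text \<open>Edges are two-element sets, so \<open>{f u, f v} \<in> E'\<close> forces \<open>f u \<noteq> f v\<close>.\<close>

definition graph_hom :: "'v set \<Rightarrow> 'v set set \<Rightarrow> 'w set \<Rightarrow> 'w set set \<Rightarrow> ('v \<Rightarrow> 'w) set" where
  "graph_hom V E V' E' = {f \<in> V \<rightarrow> V'. \<forall>u\<in>V. \<forall>v\<in>V. {u, v} \<in> E \<longrightarrow> {f u, f v} \<in> E'}"

definition graph_AutGroup :: "'v set \<Rightarrow> 'v set set \<Rightarrow> ('v \<Rightarrow> 'v) monoid" where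
  "graph_AutGroup V E = BijGroup V
     \<lparr>carrier := {f \<in> Bij V. f \<in> graph_hom V E V E \<and> inv_into V f \<in> graph_hom V E V E}\<rparr>"

definition clique :: "'v set \<Rightarrow> 'v set set \<Rightarrow> 'v set \<Rightarrow> bool" where
  "clique V E C \<longleftrightarrow> C \<subseteq> V \<and> (\<forall>u\<in>C. \<forall>v\<in>C. u \<noteq> v \<longrightarrow> {u, v} \<in> E)"

text \<open>Only the values of \<open>pprod\<close> on \<open>pdom\<close> and of \<open>pinv\<close> on \<open>pcarrier\<close> are meaningful.\<close>

record 'a partial_group =
  pcarrier :: "'a set"
  pdom :: "'a list set"
  pprod :: "'a list \<Rightarrow> 'a"
  pinv :: "'a \<Rightarrow> 'a"

locale partial_group =
  fixes M :: "'a partial_group"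
  assumes carrier_nonempty: "pcarrier M \<noteq> {}"
    and dom_words: "pdom M \<subseteq> lists (pcarrier M)"
    and prod_closed: "u \<in> pdom M \<Longrightarrow> pprod M u \<in> pcarrier M"
    and dom_singleton: "x \<in> pcarrier M \<Longrightarrow> [x] \<in> pdom M"
    and dom_append: "u @ v \<in> pdom M \<Longrightarrow> u \<in> pdom M \<and> v \<in> pdom M"
    and prod_singleton: "x \<in> pcarrier M \<Longrightarrow> pprod M [x] = x"
    and dom_prod: "u @ v @ w \<in> pdom M \<Longrightarrow> u @ [pprod M v] @ w \<in> pdom M"
    and prod_prod: "u @ v @ w \<in> pdom M \<Longrightarrow> pprod M (u @ v @ w) = pprod M (u @ [pprod M v] @ w)"
    and inv_closed: "x \<in> pcarrier M \<Longrightarrow> pinv M x \<in> pcarrier M"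
    and inv_inv: "x \<in> pcarrier M \<Longrightarrow> pinv M (pinv M x) = x"
    and dom_inv: "u \<in> pdom M \<Longrightarrow> rev (map (pinv M) u) @ u \<in> pdom M"
    and prod_inv: "u \<in> pdom M \<Longrightarrow> pprod M (rev (map (pinv M) u) @ u) = pprod M []"

definition partial_hom :: "'a partial_group \<Rightarrow> 'b partial_group \<Rightarrow> ('a \<Rightarrow> 'b) set" where
  "partial_hom M N = {\<phi> \<in> pcarrier M \<rightarrow> pcarrier N.
     \<forall>u \<in> pdom M. map \<phi> u \<in> pdom N \<and> pprod N (map \<phi> u) = \<phi> (pprod M u)}"

definition partial_AutGroup :: "'a partial_group \<Rightarrow> ('a \<Rightarrow> 'a) monoid" where
  "partial_AutGroup M = BijGroup (pcarrier M)
     \<lparr>carrier := {\<phi> \<in> Bij (pcarrier M).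
        \<phi> \<in> partial_hom M M \<and> inv_into (pcarrier M) \<phi> \<in> partial_hom M M}\<rparr>"

text \<open>The letter \<open>(v, g)\<close> is the element \<open>g\<close> of \<open>H v\<close>; the tag \<open>v\<close> makes the sets of
  non-identity elements of the groups disjoint.\<close>

definition letters :: "('v \<Rightarrow> 'h monoid) \<Rightarrow> 'v set \<Rightarrow> ('v \<times> 'h) set" where
  "letters H C = (SIGMA v:C. carrier (H v) - {\<one>\<^bsub>H v\<^esub>})"

definition reduced :: "('v \<times> 'h) list \<Rightarrow> bool" where
  "reduced w \<longleftrightarrow> successively (\<lambda>x y. fst x \<noteq> fst y) w"

definition cyclically_reduced :: "('v \<times> 'h) list \<Rightarrow> bool" where
  "cyclically_reduced w \<longleftrightarrow> (\<forall>n. reduced (rotate n w))"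

inductive reduction :: "('v \<Rightarrow> 'h monoid) \<Rightarrow> ('v \<times> 'h) list \<Rightarrow> ('v \<times> 'h) list \<Rightarrow> bool"
  for H :: "'v \<Rightarrow> 'h monoid" where
  cancel: "g \<otimes>\<^bsub>H v\<^esub> h = \<one>\<^bsub>H v\<^esub> \<Longrightarrow> reduction H (x @ [(v, g), (v, h)] @ y) (x @ y)"
| combine: "g \<otimes>\<^bsub>H v\<^esub> h \<noteq> \<one>\<^bsub>H v\<^esub> \<Longrightarrow>
    reduction H (x @ [(v, g), (v, h)] @ y) (x @ [(v, g \<otimes>\<^bsub>H v\<^esub> h)] @ y)"

definition reduced_form :: "('v \<Rightarrow> 'h monoid) \<Rightarrow> ('v \<times> 'h) list \<Rightarrow> ('v \<times> 'h) list" where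
  "reduced_form H w = (THE w'. (reduction H)\<^sup>*\<^sup>* w w' \<and> reduced w')"

definition CR :: "('v \<Rightarrow> 'h monoid) \<Rightarrow> 'v set \<Rightarrow> ('v \<times> 'h) list set" where
  "CR H C = {w \<in> lists (letters H C). cyclically_reduced w}"

definition CR_dom :: "('v \<Rightarrow> 'h monoid) \<Rightarrow> 'v set \<Rightarrow> ('v \<times> 'h) list list set" where
  "CR_dom H C = {us \<in> lists (CR H C). \<forall>i j. i \<le> j \<and> j < length us \<longrightarrow>
     reduced_form H (concat (map ((!) us) [i..<Suc j])) \<in> CR H C}"

text \<open>On reduced words this is inversion in the free product.\<close>

definition word_inv :: "('v \<Rightarrow> 'h monoid) \<Rightarrow> ('v \<times> 'h) list \<Rightarrow> ('v \<times> 'h) list" where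
  "word_inv H w = rev (map (\<lambda>(v, g). (v, inv\<^bsub>H v\<^esub> g)) w)"

definition clique_partial_group ::
    "('v \<Rightarrow> 'h monoid) \<Rightarrow> 'v set \<Rightarrow> ('v \<times> 'h) list partial_group" where
  "clique_partial_group H C =
     \<lparr>pcarrier = CR H C, pdom = CR_dom H C,
      pprod = (\<lambda>us. reduced_form H (concat us)), pinv = word_inv H\<rparr>"

text \<open>The colimit of the \<^const>\<open>clique_partial_group\<close>s over all cliques (the empty one included).
  The product and the inversion do not depend on the clique, so it is their union.\<close>

definition graph_partial_group ::
    "'v set \<Rightarrow> 'v set set \<Rightarrow> ('v \<Rightarrow> 'h monoid) \<Rightarrow> ('v \<times> 'h) list partial_group" where
  "graph_partial_group V E H =
     \<lparr>pcarrier = (\<Union>C \<in> Collect (clique V E). pcarrier (clique_partial_group H C)),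
      pdom = (\<Union>C \<in> Collect (clique V E). pdom (clique_partial_group H C)),
      pprod = (\<lambda>us. reduced_form H (concat us)), pinv = word_inv H\<rparr>"

text \<open>The description in \<^const>\<open>reduced_form\<close> is proper, and the structures above satisfy the
  axioms of a partial group. The fold of \<open>letter_mult\<close> below computes the reduced form.\<close>

fun letter_mult :: "('v \<Rightarrow> 'h monoid) \<Rightarrow> 'v \<times> 'h \<Rightarrow> ('v \<times> 'h) list \<Rightarrow> ('v \<times> 'h) list" where
  "letter_mult H (v, g) [] = [(v, g)]"
| "letter_mult H (v, g) ((v', h) # w) =
     (if v \<noteq> v' then (v, g) # (v', h) # w
      else if g \<otimes>\<^bsub>H v\<^esub> h = \<one>\<^bsub>H v\<^esub> then w else (v, g \<otimes>\<^bsub>H v\<^esub> h) # w)"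

lemma reduced_Cons: "reduced (x # w) \<longleftrightarrow> (w = [] \<or> fst x \<noteq> fst (hd w)) \<and> reduced w"
  by (auto simp: reduced_def successively_Cons)

lemma reduced_Nil [simp]: "reduced []"
  by (simp add: reduced_def)

lemma letter_mult_in:
  assumes "\<And>v. v \<in> C \<Longrightarrow> group (H v)" "x \<in> letters H C" "w \<in> lists (letters H C)"
  shows "letter_mult H x w \<in> lists (letters H C)"
  using assms
  by (cases "(H, x, w)" rule: letter_mult.cases)
     (auto simp: letters_def intro: monoid.m_closed group.is_monoid)

lemma letter_mult_reduced: "reduced w \<Longrightarrow> reduced (letter_mult H x w)"
  by (cases "(H, x, w)" rule: letter_mult.cases) (auto simp: reduced_Cons)

lemma reduction_cong: "reduction H w w' \<Longrightarrow> reduction H (a @ w @ b) (a @ w' @ b)"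
proof (induction rule: reduction.induct)
  case (cancel v g h x y)
  then show ?case using reduction.cancel[of H v g h "a @ x" "y @ b"] by simp
next
  case (combine v g h x y)
  then show ?case using reduction.combine[of H v g h "a @ x" "y @ b"] by simp
qed

lemma reductions_cong: "(reduction H)\<^sup>*\<^sup>* w w' \<Longrightarrow> (reduction H)\<^sup>*\<^sup>* (a @ w @ b) (a @ w' @ b)"
  by (induction rule: rtranclp_induct) (auto intro: rtranclp.rtrancl_into_rtrancl reduction_cong)

lemma letter_mult_reduction: "(reduction H)\<^sup>*\<^sup>* (x # w) (letter_mult H x w)"
proof (cases "(H, x, w)" rule: letter_mult.cases)
  case (2 H' v g v' h w')
  then show ?thesis
    using reduction.cancel[of H v g h "[]" w'] reduction.combine[of H v g h "[]" w'] by auto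
qed auto

lemma reduction_in:
  assumes "\<And>v. v \<in> C \<Longrightarrow> group (H v)" "reduction H w w'" "w \<in> lists (letters H C)"
  shows "w' \<in> lists (letters H C)"
  using assms(2,3,1)
  by (induction rule: reduction.induct) (auto simp: letters_def intro: monoid.m_closed group.is_monoid)

lemma reductions_in:
  assumes "\<And>v. v \<in> C \<Longrightarrow> group (H v)" "(reduction H)\<^sup>*\<^sup>* w w'" "w \<in> lists (letters H C)"
  shows "w' \<in> lists (letters H C)"
  using assms(2,3)
proof (induction rule: rtranclp_induct)
  case (step y z)
  then show ?case using reduction_in[of C H y z, OF assms(1)] by simp
qed

lemma foldr_letter_mult_in:
  assumes "\<And>v. v \<in> C \<Longrightarrow> group (H v)" "w \<in> lists (letters H C)"
  shows "foldr (letter_mult H) w [] \<in> lists (letters H C)"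
  using assms(2) proof (induction w)
  case (Cons x w)
  then show ?case using letter_mult_in[of C H x, OF assms(1)] by simp
qed simp

lemma foldr_letter_mult_reduced: "reduced (foldr (letter_mult H) w [])"
  by (induction w) (auto intro: letter_mult_reduced)

lemma foldr_letter_mult_reduction: "(reduction H)\<^sup>*\<^sup>* w (foldr (letter_mult H) w [])"
proof (induction w)
  case (Cons x w)
  have "(reduction H)\<^sup>*\<^sup>* (x # w) (x # foldr (letter_mult H) w [])"
    using reductions_cong[OF Cons, of "[x]" "[]"] by simp
  then show ?case using letter_mult_reduction[of H x "foldr (letter_mult H) w []"] by simp
qed simp

lemma letter_mult_assoc:
  assumes "group (H v)" "(v, g) \<in> letters H C" "(v, h) \<in> letters H C" "w \<in> lists (letters H C)" "reduced w"
  shows "letter_mult H (v, g) (letter_mult H (v, h) w) =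
    (if g \<otimes>\<^bsub>H v\<^esub> h = \<one>\<^bsub>H v\<^esub> then w else letter_mult H (v, g \<otimes>\<^bsub>H v\<^esub> h) w)"
proof -
  interpret group "H v" by fact
  have gh: "g \<in> carrier (H v)" "h \<in> carrier (H v)" "g \<noteq> \<one>\<^bsub>H v\<^esub>" "h \<noteq> \<one>\<^bsub>H v\<^esub>"
    using assms by (auto simp: letters_def)
  show ?thesis
  proof (cases "w \<noteq> [] \<and> fst (hd w) = v")
    case False
    then show ?thesis using gh by (cases w) auto
  next
    case True
    then obtain k w' where w: "w = (v, k) # w'" by (cases w) auto
    have k: "k \<in> carrier (H v)" "k \<noteq> \<one>\<^bsub>H v\<^esub>" using assms w by (auto simp: letters_def)
    have *: "letter_mult H (v, a) w' = (v, a) # w'" for a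
      using assms(5) w by (cases w') (auto simp: reduced_Cons)
    have e1: "g \<otimes>\<^bsub>H v\<^esub> h \<otimes>\<^bsub>H v\<^esub> k = g \<otimes>\<^bsub>H v\<^esub> (h \<otimes>\<^bsub>H v\<^esub> k)" using gh k by (simp add: m_assoc)
    show ?thesis
      using gh k * w e1 by auto
  qed
qed

lemma reduction_foldr_letter_mult:
  assumes G: "\<And>v. v \<in> C \<Longrightarrow> group (H v)" and "reduction H w w'" "w \<in> lists (letters H C)"
  shows "foldr (letter_mult H) w [] = foldr (letter_mult H) w' []"
  using assms(2,3)
proof (induction rule: reduction.induct)
  case (cancel v g h x y)
  then have "group (H v)" "(v, g) \<in> letters H C" "(v, h) \<in> letters H C" 
    "foldr (letter_mult H) y [] \<in> lists (letters H C)"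
    using G foldr_letter_mult_in[OF G, where w = y] by (auto simp: letters_def)
  from letter_mult_assoc[OF this foldr_letter_mult_reduced] show ?case using cancel by simp
next
  case (combine v g h x y)
  then have "group (H v)" "(v, g) \<in> letters H C" "(v, h) \<in> letters H C" 
    "foldr (letter_mult H) y [] \<in> lists (letters H C)"
    using G foldr_letter_mult_in[OF G, where w = y] by (auto simp: letters_def)
  from letter_mult_assoc[OF this foldr_letter_mult_reduced] show ?case using combine by simp
qed

lemma reductions_foldr_letter_mult:
  assumes G: "\<And>v. v \<in> C \<Longrightarrow> group (H v)" and "(reduction H)\<^sup>*\<^sup>* w w'" "w \<in> lists (letters H C)"
  shows "foldr (letter_mult H) w [] = foldr (letter_mult H) w' []"
  using assms(2,3)
proof (induction rule: rtranclp_induct)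
  case (step y z)
  then have "y \<in> lists (letters H C)" using reductions_in[of C H w y, OF G] by simp
  with step show ?case using reduction_foldr_letter_mult[of C H y z, OF G] by simp
qed simp

lemma foldr_letter_mult_id: "reduced w \<Longrightarrow> foldr (letter_mult H) w [] = w"
proof (induction w)
  case (Cons x w)
  then show ?case by (cases x; cases w) (auto simp: reduced_Cons)
qed simp

lemma ex1_reduced_form:
  assumes "\<And>v. v \<in> C \<Longrightarrow> group (H v)" "w \<in> lists (letters H C)"
  shows "\<exists>!w'. (reduction H)\<^sup>*\<^sup>* w w' \<and> reduced w'"
proof (rule ex1I[of _ "foldr (letter_mult H) w []"])
  show "(reduction H)\<^sup>*\<^sup>* w (foldr (letter_mult H) w []) \<and> reduced (foldr (letter_mult H) w [])"
    by (simp add: foldr_letter_mult_reduction foldr_letter_mult_reduced)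
next
  fix w' assume "(reduction H)\<^sup>*\<^sup>* w w' \<and> reduced w'"
  then show "w' = foldr (letter_mult H) w []"
    using reductions_foldr_letter_mult[of C H w w', OF assms(1) _ assms(2)] foldr_letter_mult_id[of w' H] by simp
qed

lemma reduced_form_props:
  assumes "\<And>v. v \<in> C \<Longrightarrow> group (H v)" "w \<in> lists (letters H C)"
  shows "(reduction H)\<^sup>*\<^sup>* w (reduced_form H w)" "reduced (reduced_form H w)"
    "reduced_form H w \<in> lists (letters H C)"
proof -
  show *: "(reduction H)\<^sup>*\<^sup>* w (reduced_form H w)" and "reduced (reduced_form H w)"
    using theI'[OF ex1_reduced_form[of C H w, OF assms]] unfolding reduced_form_def by simp_all
  show "reduced_form H w \<in> lists (letters H C)"
    by (rule reductions_in[of C H w, OF assms(1) * assms(2)])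
qed

lemma reduced_form_eqI:
  assumes "\<And>v. v \<in> C \<Longrightarrow> group (H v)" "w \<in> lists (letters H C)" "(reduction H)\<^sup>*\<^sup>* w w'"
  shows "reduced_form H w = reduced_form H w'"
proof -
  have "w' \<in> lists (letters H C)" by (rule reductions_in[of C H w, OF assms(1,3,2)])
  note w' = reduced_form_props[of C H w', OF assms(1) this]
  have "(reduction H)\<^sup>*\<^sup>* w (reduced_form H w')" using assms(3) w'(1) by (rule rtranclp_trans)
  then show ?thesis
    using ex1_reduced_form[of C H w, OF assms(1,2)] reduced_form_props(1,2)[of C H w, OF assms(1,2)] w'(2)
    by blast
qed

lemma reduced_form_id:
  assumes "\<And>v. v \<in> C \<Longrightarrow> group (H v)" "w \<in> lists (letters H C)" "reduced w"
  shows "reduced_form H w = w"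
  using ex1_reduced_form[of C H w, OF assms(1,2)] reduced_form_props(1,2)[of C H w, OF assms(1,2)] assms(3)
  by blast

lemma reduced_word_inv: "reduced (word_inv H w) \<longleftrightarrow> reduced w"
  unfolding reduced_def word_inv_def
  by (simp add: successively_map case_prod_beta eq_commute neq_commute)

lemma rotate_word_inv: "\<exists>m. rotate n (word_inv H w) = word_inv H (rotate m w)"
  unfolding word_inv_def by (auto simp: rotate_rev rotate_map)

lemma letters_inv:
  assumes "\<And>v. v \<in> C \<Longrightarrow> group (H v)" "(v, g) \<in> letters H C"
  shows "(v, inv\<^bsub>H v\<^esub> g) \<in> letters H C"
  using assms by (simp add: letters_def group.inv_eq_1_iff group.inv_closed)

lemma word_inv_in:
  assumes "\<And>v. v \<in> C \<Longrightarrow> group (H v)" "w \<in> lists (letters H C)"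
  shows "word_inv H w \<in> lists (letters H C)"
  using assms(2) letters_inv[of C H, OF assms(1)] by (auto simp: word_inv_def)

lemma word_inv_CR:
  assumes "\<And>v. v \<in> C \<Longrightarrow> group (H v)" "w \<in> CR H C"
  shows "word_inv H w \<in> CR H C"
proof -
  have "cyclically_reduced (word_inv H w)"
    unfolding cyclically_reduced_def
  proof
    fix n
    obtain m where "rotate n (word_inv H w) = word_inv H (rotate m w)"
      using rotate_word_inv by blast
    then show "reduced (rotate n (word_inv H w))"
      using assms(2) by (simp add: reduced_word_inv CR_def cyclically_reduced_def)
  qed
  moreover have "word_inv H w \<in> lists (letters H C)"
    using assms(2) by (intro word_inv_in assms(1)) (simp_all add: CR_def)
  ultimately show ?thesis by (simp add: CR_def)
qed

lemma word_inv_append: "word_inv H (x @ y) = word_inv H y @ word_inv H x"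
  by (simp add: word_inv_def)

lemma word_inv_word_inv:
  assumes "\<And>v. v \<in> C \<Longrightarrow> group (H v)" "w \<in> lists (letters H C)"
  shows "word_inv H (word_inv H w) = w"
proof -
  have "map ((\<lambda>(v, g). (v, inv\<^bsub>H v\<^esub> g)) \<circ> (\<lambda>(v, g). (v, inv\<^bsub>H v\<^esub> g))) w = map id w"
    by (rule map_cong) (use assms in \<open>auto simp: letters_def\<close>)
  then show ?thesis by (simp add: word_inv_def rev_map)
qed

lemma word_inv_cancel:
  assumes "\<And>v. v \<in> C \<Longrightarrow> group (H v)" "w \<in> lists (letters H C)"
  shows "(reduction H)\<^sup>*\<^sup>* (word_inv H w @ w) []"
  using assms(2)
proof (induction w rule: list.induct)
  case (Cons x w)
  obtain v g where x: "x = (v, g)" by fastforce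
  have "v \<in> C" "g \<in> carrier (H v)" using Cons.prems x by (auto simp: letters_def)
  then have "inv\<^bsub>H v\<^esub> g \<otimes>\<^bsub>H v\<^esub> g = \<one>\<^bsub>H v\<^esub>" using assms(1) by (simp add: group.l_inv)
  from reduction.cancel[of H, OF this, of "word_inv H w" w] have
    "reduction H (word_inv H (x # w) @ x # w) (word_inv H w @ w)"
    by (simp add: x word_inv_def)
  with Cons show ?case by (auto intro: converse_rtranclp_into_rtranclp)
qed (simp add: word_inv_def)

lemma reduction_word_inv:
  assumes "\<And>v. v \<in> C \<Longrightarrow> group (H v)" "w \<in> lists (letters H C)" "reduction H w w'"
  shows "reduction H (word_inv H w) (word_inv H w')"
  using assms(3,2)
proof (induction rule: reduction.induct)
  case (cancel v g h x y)
  then have v: "v \<in> C" "g \<in> carrier (H v)" "h \<in> carrier (H v)" by (auto simp: letters_def)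
  interpret group "H v" using assms(1) v by blast
  have "inv\<^bsub>H v\<^esub> h \<otimes>\<^bsub>H v\<^esub> inv\<^bsub>H v\<^esub> g = \<one>\<^bsub>H v\<^esub>" using v cancel by (metis inv_mult_group inv_one)
  from reduction.cancel[of H, OF this, of "word_inv H y" "word_inv H x"] show ?case by (simp add: word_inv_def)
next
  case (combine v g h x y)
  then have v: "v \<in> C" "g \<in> carrier (H v)" "h \<in> carrier (H v)" by (auto simp: letters_def)
  interpret group "H v" using assms(1) v by blast
  have "inv\<^bsub>H v\<^esub> h \<otimes>\<^bsub>H v\<^esub> inv\<^bsub>H v\<^esub> g = inv\<^bsub>H v\<^esub> (g \<otimes>\<^bsub>H v\<^esub> h)" using v by (metis inv_mult_group)
  moreover have "inv\<^bsub>H v\<^esub> (g \<otimes>\<^bsub>H v\<^esub> h) \<noteq> \<one>\<^bsub>H v\<^esub>" using v combine by (simp add: inv_eq_1_iff)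
  ultimately show ?case using reduction.combine[of H v "inv\<^bsub>H v\<^esub> h" "inv\<^bsub>H v\<^esub> g" "word_inv H y" "word_inv H x"]
    by (simp add: word_inv_def)
qed

lemma reduced_form_word_inv:
  assumes G: "\<And>v. v \<in> C \<Longrightarrow> group (H v)" and w: "w \<in> lists (letters H C)"
  shows "reduced_form H (word_inv H w) = word_inv H (reduced_form H w)"
proof -
  have "(reduction H)\<^sup>*\<^sup>* (word_inv H w) (word_inv H w')" if "(reduction H)\<^sup>*\<^sup>* w w'" for w'
    using that
  proof (induction rule: rtranclp_induct)
    case (step y z)
    then have "y \<in> lists (letters H C)" using reductions_in[of C H w y, OF G _ w] by simp
    then have "reduction H (word_inv H y) (word_inv H z)"
      using reduction_word_inv[of C H y z, OF G] step by simp
    then show ?case using step by simp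
  qed simp
  from reduced_form_eqI[of C H, OF G word_inv_in[OF G w] this[OF reduced_form_props(1)[of C H w, OF G w]]]
  have "reduced_form H (word_inv H w) = reduced_form H (word_inv H (reduced_form H w))" by simp
  also have "\<dots> = word_inv H (reduced_form H w)"
    using reduced_form_props(2,3)[of C H w, OF G w]
    by (intro reduced_form_id[of C H] word_inv_in G) (simp_all add: reduced_word_inv)
  finally show ?thesis .
qed

lemma Nil_CR: "[] \<in> CR H C"
  by (simp add: CR_def cyclically_reduced_def)

lemma CR_dom_iff:
  "us \<in> CR_dom H C \<longleftrightarrow> us \<in> lists (CR H C) \<and>
     (\<forall>x y z. us = x @ y @ z \<and> y \<noteq> [] \<longrightarrow> reduced_form H (concat y) \<in> CR H C)"
proof -
  have eq: "map ((!) us) [i..<Suc j] = take (Suc j - i) (drop i us)" if "j < length us" for i j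
    by (rule nth_equalityI) (use that in \<open>auto simp del: upt_Suc\<close>)
  have "(\<forall>i j. i \<le> j \<and> j < length us \<longrightarrow> reduced_form H (concat (map ((!) us) [i..<Suc j])) \<in> CR H C)
     \<longleftrightarrow> (\<forall>x y z. us = x @ y @ z \<and> y \<noteq> [] \<longrightarrow> reduced_form H (concat y) \<in> CR H C)" (is "?L \<longleftrightarrow> ?R")
  proof
    assume L: ?L
    show ?R
    proof (intro allI impI, elim conjE)
      fix x y z assume us: "us = x @ y @ z" "y \<noteq> []"
      have "map ((!) us) [length x..<Suc (length x + length y - 1)] = y"
        using us eq[of "length x + length y - 1" "length x"] by (cases y) (simp_all del: upt_Suc)
      with L[rule_format, of "length x" "length x + length y - 1"] us
      show "reduced_form H (concat y) \<in> CR H C" by (cases y) (simp_all del: upt_Suc)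
    qed
  next
    assume R: ?R
    show ?L
    proof (intro allI impI, elim conjE)
      fix i j assume ij: "i \<le> j" "j < length us"
      have "us = take i us @ take (Suc j - i) (drop i us) @ drop (Suc j - i) (drop i us)"
        by (simp only: append_take_drop_id)
      moreover have "take (Suc j - i) (drop i us) \<noteq> []" using ij by auto
      ultimately show "reduced_form H (concat (map ((!) us) [i..<Suc j])) \<in> CR H C"
        using R eq[OF ij(2)] by metis
    qed
  qed
  then show ?thesis by (auto simp: CR_dom_def)
qed

lemma CR_concat: "us \<in> lists (CR H C) \<Longrightarrow> concat us \<in> lists (letters H C)"
  by (fastforce simp: CR_def)

theorem partial_group_clique:
  assumes G: "\<And>v. v \<in> C \<Longrightarrow> group (H v)"
  shows "partial_group (clique_partial_group H C)"
proof -
  let ?R = "reduced_form H"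
  let ?L = "lists (letters H C)"
  have red1: "(reduction H)\<^sup>*\<^sup>* w (?R w)" and Rl: "?R w \<in> ?L" if "w \<in> ?L" for w
    using reduced_form_props[of C H w] G that by blast+
  have Req: "?R w = ?R w'" if "w \<in> ?L" "(reduction H)\<^sup>*\<^sup>* w w'" for w w'
    using reduced_form_eqI[of C H w w'] G that by blast
  have Rid: "?R w = w" if "w \<in> ?L" "reduced w" for w
    using reduced_form_id[of C H w] G that by blast
  have iCR: "word_inv H w \<in> CR H C" if "w \<in> CR H C" for w
    using word_inv_CR[of C H w] G that by blast
  have ii: "word_inv H (word_inv H w) = w" and iin: "word_inv H w \<in> ?L"
    and ican: "(reduction H)\<^sup>*\<^sup>* (word_inv H w @ w) []"
    and Rinv: "?R (word_inv H w) = word_inv H (?R w)" if "w \<in> ?L" for w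
    using word_inv_word_inv[of C H w] word_inv_in[of C H w] word_inv_cancel[of C H w]
      reduced_form_word_inv[of C H w] G that by blast+
  have CRl: "x \<in> lists (letters H C)" "reduced x" if "x \<in> CR H C" for x
    using that by (auto simp: CR_def cyclically_reduced_def dest: spec[of _ 0])
  have RN: "?R [] = []" using Rid[of "[]"] by simp
  have sub: "?R (concat y) \<in> CR H C" if "x @ y @ z \<in> CR_dom H C" for x y z
    using that Nil_CR[of H C] RN unfolding CR_dom_iff by (cases "y = []") (simp, blast)
  have Rin: "?R (concat v) \<in> lists (letters H C)" if "v \<in> lists (CR H C)" for v
    using Rl[OF CR_concat[OF that]] .
  have Rcong: "?R (x @ ?R (concat v) @ z) = ?R (x @ concat v @ z)"
    if "x \<in> lists (letters H C)" "z \<in> lists (letters H C)" "v \<in> lists (CR H C)" for x v z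
  proof -
    have "x @ concat v @ z \<in> lists (letters H C)" using that CR_concat[of v] by simp
    from Req[OF this, OF reductions_cong, OF red1[OF CR_concat], OF that(3)]
    show ?thesis by simp
  qed
  have sub': "x \<in> CR_dom H C \<and> y \<in> CR_dom H C" if "x @ y \<in> CR_dom H C" for x y
  proof -
    have "x \<in> lists (CR H C)" "y \<in> lists (CR H C)" using that by (auto simp: CR_dom_def)
    moreover have "reduced_form H (concat b) \<in> CR H C" if "x = a @ b @ c" for a b c
      using sub[of a b "c @ y"] \<open>x @ y \<in> CR_dom H C\<close> that by simp
    moreover have "reduced_form H (concat b) \<in> CR H C" if "y = a @ b @ c" for a b c
      using sub[of "x @ a" b c] \<open>x @ y \<in> CR_dom H C\<close> that by simp
    ultimately show ?thesis unfolding CR_dom_iff by blast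
  qed
  show ?thesis
  proof (unfold_locales, unfold clique_partial_group_def partial_group.simps)
    show "CR H C \<noteq> {}" using Nil_CR by blast
    show "CR_dom H C \<subseteq> lists (CR H C)" by (auto simp: CR_dom_def)
  next
    fix u assume "u \<in> CR_dom H C"
    then show "?R (concat u) \<in> CR H C" using sub[of "[]" u "[]"] by simp
  next
    fix x assume x: "x \<in> CR H C"
    show "[x] \<in> CR_dom H C"
      using x Rid CRl by (auto simp: CR_dom_def)
    show "?R (concat [x]) = x" using x Rid CRl by simp
    show "word_inv H x \<in> CR H C" using iCR[OF x] .
    show "word_inv H (word_inv H x) = x" using ii[OF CRl(1)[OF x]] .
  next
    fix u v assume "u @ v \<in> CR_dom H C"
    then show "u \<in> CR_dom H C \<and> v \<in> CR_dom H C" by (rule sub')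
  next
    fix u v w assume a: "u @ v @ w \<in> CR_dom H C"
    have l: "u \<in> lists (CR H C)" "v \<in> lists (CR H C)" "w \<in> lists (CR H C)" using a by (auto simp: CR_dom_def)
    show "u @ [?R (concat v)] @ w \<in> CR_dom H C"
      unfolding CR_dom_iff
    proof (intro conjI allI impI, goal_cases)
      case 1
      then show ?case using l sub[OF a] by auto
    next
      case (2 x y z)
      then have e: "u @ ?R (concat v) # w = x @ y @ z" by simp
      consider (U) t where "u = x @ y @ t" | (W) t where "w = t @ y @ z"
        | (B) u2 w1 where "y = u2 @ ?R (concat v) # w1" "u = x @ u2" "w = w1 @ z"
        using e by (fastforce simp: append_eq_append_conv2 append_eq_Cons_conv Cons_eq_append_conv)
      then show ?case
      proof cases
        case U then show ?thesis using sub[of x y "t @ v @ w"] a by simp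
      next
        case W then show ?thesis using sub[of "u @ v @ t" y z] a by simp
      next
        case B
        have "?R (concat y) = ?R (concat (u2 @ v @ w1))"
          using Rcong[OF CR_concat CR_concat l(2), of u2 w1] l B by simp
        then show ?thesis using sub[of x "u2 @ v @ w1" z] a B by simp
      qed
    qed
    show "?R (concat (u @ v @ w)) = ?R (concat (u @ [?R (concat v)] @ w))"
      using Rcong[OF CR_concat CR_concat] l by simp
  next
    fix u assume u: "u \<in> CR_dom H C"
    then have ul: "u \<in> lists (CR H C)" by (simp add: CR_dom_def)
    have ci: "concat (rev (map (word_inv H) p)) = word_inv H (concat p)" for p
      by (induction p) (auto simp: word_inv_append, simp add: word_inv_def)
    have can: "?R (x @ word_inv H (concat p) @ concat p @ z) = ?R (x @ z)"
      if "x \<in> lists (letters H C)" "z \<in> lists (letters H C)" "p \<in> lists (CR H C)" for x p z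
    proof -
      have "x @ (word_inv H (concat p) @ concat p) @ z \<in> lists (letters H C)"
        using that CR_concat[of p] iin[OF CR_concat, of p] by simp
      from Req[OF this, OF reductions_cong, OF ican[OF CR_concat[OF that(3)]]]
      show ?thesis by simp
    qed
    have key: "?R (concat (rev (map (word_inv H) p) @ q)) \<in> CR H C"
      if pq: "u = p @ p'" "u = q @ q'" for p p' q q'
    proof -
      have "(\<exists>r. p = q @ r) \<or> (\<exists>r. q = p @ r)" using pq by (metis append_eq_append_conv2)
      then consider r where "p = q @ r" | r where "q = p @ r" by blast
      then show ?thesis
      proof cases
        case 1
        have l: "r \<in> lists (CR H C)" "q \<in> lists (CR H C)" using 1 pq ul by auto
        have "?R (concat (rev (map (word_inv H) p) @ q)) = ?R (word_inv H (concat r))"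
          using can[OF iin[OF CR_concat[OF l(1)]] _ l(2), of "[]"] 1 by (simp only: concat_append ci) (simp add: word_inv_append)
        also have "\<dots> = word_inv H (?R (concat r))" using Rinv[OF CR_concat[OF l(1)]] .
        also have "\<dots> \<in> CR H C" using iCR sub[of q r p'] u 1 pq by simp
        finally show ?thesis .
      next
        case 2
        have l: "r \<in> lists (CR H C)" "p \<in> lists (CR H C)" using 2 pq ul by auto
        have "?R (concat (rev (map (word_inv H) p) @ q)) = ?R (concat r)"
          using can[OF _ CR_concat[OF l(1)] l(2), of "[]"] 2 by (simp only: concat_append ci) simp
        also have "\<dots> \<in> CR H C" using sub[of p r q'] u 2 pq by simp
        finally show ?thesis .
      qed
    qed
    show "rev (map (word_inv H) u) @ u \<in> CR_dom H C"
      unfolding CR_dom_iff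
    proof (intro conjI allI impI, goal_cases)
      case 1
      then show ?case using ul iCR by auto
    next
      case (2 x y z)
      then have e: "rev (map (word_inv H) u) @ u = x @ y @ z" by simp
      consider (I) t where "rev (map (word_inv H) u) = x @ y @ t" | (U) t where "u = t @ y @ z"
        | (B) a b where "y = a @ b" "rev (map (word_inv H) u) = x @ a" "u = b @ z"
      proof -
        consider s where "rev (map (word_inv H) u) = x @ s" "s @ u = y @ z" | s where "u = s @ y @ z"
          using e unfolding append_eq_append_conv2 by blast
        then show thesis
        proof cases
          case (1 s)
          then consider r where "s = y @ r" | r where "y = s @ r" "u = r @ z"
            unfolding append_eq_append_conv2[of s u y z] by blast
          then show thesis using 1(1) I B by cases simp_all
        qed (rule U)
      qed
      then show ?case
      proof cases
        case I
        then have "map (word_inv H) u = rev t @ rev y @ rev x" by (metis append.assoc rev_append rev_swap)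
        then obtain t' y' x' where *: "u = t' @ y' @ x'" "map (word_inv H) y' = rev y"
          by (metis append_eq_map_conv)
        then have y: "y = rev (map (word_inv H) y')" by (simp add: rev_swap)
        have "y' \<in> lists (CR H C)" using * ul by auto
        then have "?R (concat y) = word_inv H (?R (concat y'))"
          unfolding y ci using Rinv[OF CR_concat] by simp
        then show ?thesis using iCR sub[of t' y' x'] u * by simp
      next
        case U then show ?thesis using sub[of t y z] u by simp
      next
        case B
        then have "map (word_inv H) u = rev a @ rev x" by (metis rev_append rev_swap)
        then obtain p p' where *: "u = p @ p'" "map (word_inv H) p = rev a"
          by (metis append_eq_map_conv)
        then have "a = rev (map (word_inv H) p)" by (simp add: rev_swap)
        then show ?thesis using key[OF *(1) B(3)] B by simp
      qed
    qed
    show "?R (concat (rev (map (word_inv H) u) @ u)) = ?R (concat [])"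
      using can[OF _ _ ul, of "[]" "[]"] by (simp add: ci)
  qed
qed

theorem partial_group_graph:
  assumes G: "\<And>v. v \<in> V \<Longrightarrow> group (H v)"
  shows "partial_group (graph_partial_group V E H)"
proof -
  let ?M = "clique_partial_group H" and ?N = "graph_partial_group V E H"
  have pg: "partial_group (?M C)" if "clique V E C" for C
    using that by (intro partial_group_clique) (auto simp: clique_def intro: G)
  have c: "x \<in> pcarrier ?N \<longleftrightarrow> (\<exists>C. clique V E C \<and> x \<in> pcarrier (?M C))"
    and d: "u \<in> pdom ?N \<longleftrightarrow> (\<exists>C. clique V E C \<and> u \<in> pdom (?M C))"
    and p: "pprod ?N = pprod (?M C)" and i: "pinv ?N = pinv (?M C)" for x u C
    by (auto simp: graph_partial_group_def clique_partial_group_def)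
  have cl: "clique V E {}" by (simp add: clique_def)
  show ?thesis
  proof (unfold_locales, goal_cases)
    case 1 show ?case using partial_group.carrier_nonempty[OF pg[OF cl]] c cl by blast
  next
    case 2 show ?case using partial_group.dom_words[OF pg] c d by fast
  next
    case (3 u) then show ?case using partial_group.prod_closed[OF pg] c d p by metis
  next
    case (4 x) then show ?case using partial_group.dom_singleton[OF pg] c d by metis
  next
    case (5 u v) then show ?case using partial_group.dom_append[OF pg] d by metis
  next
    case (6 x) then show ?case using partial_group.prod_singleton[OF pg] c p by metis
  next
    case (7 u v w) then show ?case using partial_group.dom_prod[OF pg] d p by metis
  next
    case (8 u v w) then show ?case using partial_group.prod_prod[OF pg] d p by metis
  next
    case (9 x) then show ?case using partial_group.inv_closed[OF pg] c i by metis
  next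
    case (10 x) then show ?case using partial_group.inv_inv[OF pg] c i by metis
  next
    case (11 u) then show ?case using partial_group.dom_inv[OF pg] d i by metis
  next
    case (12 u) then show ?case using partial_group.prod_inv[OF pg] d i p by metis
  qed
qed

end

theory Submission
  imports Defs
begin

text \<open>
  The proof recovers the vertex groups and the graph from the partial group alone, by looking at
  torsion. A cyclically reduced word \<open>w\<close> with at least two letters can be concatenated with itself
  without any reduction taking place, so no power of it is trivial; a single letter lies in a
  finite group. Hence the torsion elements are exactly the words of length at most one
  (\<open>torsion_iff\<close>), and every automorphism, as it fixes the empty word, permutes the letters. Which letters belong to the same
  vertex, and which vertices are adjacent, is visible as well: two letters can be multiplied if and
  only if their vertices are equal or adjacent, and the product is torsion in the first case and
  not in the second (\<open>same_vertex\<close>, \<open>edge\<close>). So an automorphism induces an automorphism of the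
  graph; this is the map on the right (\<open>vertex_map\<close>).

  The map on the left applies a family of automorphisms of the vertex groups to the letters of a
  word (\<open>letterwise\<close>). It is injective because letters are elements of the partial group. It
  remains to see that an automorphism \<open>\<phi>\<close> that fixes all vertices is of this form. Restricted to
  the letters of one vertex, \<open>\<phi>\<close> is a group automorphism, since all words over a single vertex
  group lie in the domain of the product. For longer words, the letters of a cyclically reduced
  word need not form a word in the domain: in \<open>a b a' c\<close>, with \<open>a\<close> and \<open>a'\<close> at the same vertex,
  the part \<open>a b a'\<close> is not cyclically reduced. But every cyclically reduced word with at least two
  letters can be cut into two shorter nonempty cyclically reduced words
  (\<open>split_cyclically_reduced\<close>), and these two can be multiplied. By induction on the length, a
  homomorphism is determined by its values on letters (\<open>hom_eq_if_eq_on_letters\<close>).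
\<close>

section \<open>Invertible elements of a transformation monoid\<close>

text \<open>Automorphisms of partial groups and of graphs are both the invertible elements of a set of
  structure-preserving maps, and are treated together here. The maps in \<open>K\<close> may take arbitrary
  values outside \<open>S\<close>, as \<^const>\<open>partial_hom\<close> and \<^const>\<open>graph_hom\<close> do not restrict them; hence
  the closure under changes there.\<close>

locale transformation_monoid =
  fixes S :: "'a set" and K :: "('a \<Rightarrow> 'a) set"
  assumes maps: "f \<in> K \<Longrightarrow> f \<in> S \<rightarrow> S"
    and identity: "(\<lambda>x\<in>S. x) \<in> K"
    and compose_closed: "\<lbrakk>f \<in> K; g \<in> K\<rbrakk> \<Longrightarrow> compose S f g \<in> K"
    and cong_closed: "\<lbrakk>f \<in> K; \<And>x. x \<in> S \<Longrightarrow> g x = f x\<rbrakk> \<Longrightarrow> g \<in> K"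
begin

abbreviation units :: "('a \<Rightarrow> 'a) set" where
  "units \<equiv> {f \<in> Bij S. f \<in> K \<and> inv_into S f \<in> K}"

abbreviation UnitGroup :: "('a \<Rightarrow> 'a) monoid" where
  "UnitGroup \<equiv> BijGroup S\<lparr>carrier := units\<rparr>"

lemma unitI:
  assumes f: "f \<in> K" "f \<in> extensional S" and g: "g \<in> K"
    and "compose S f g = (\<lambda>x\<in>S. x)" "compose S g f = (\<lambda>x\<in>S. x)"
  shows "f \<in> units"
proof -
  have fg: "f (g x) = x" and gf: "g (f x) = x" if "x \<in> S" for x
    using fun_cong[OF assms(4), of x] fun_cong[OF assms(5), of x] that by (simp_all add: compose_eq)
  have b: "bij_betw f S S"
    by (rule bij_betw_byWitness[of S g]) (use maps[OF f(1)] maps[OF g] fg gf in auto)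
  have "inv_into S f x = g x" if "x \<in> S" for x
  proof -
    have "inv_into S f (f (g x)) = g x"
      using maps[OF g] that b by (intro inv_into_f_f) (auto simp: bij_betw_def)
    then show ?thesis using fg that by simp
  qed
  then have "inv_into S f \<in> K" by (rule cong_closed[OF g])
  then show ?thesis using b f by (simp add: Bij_def)
qed

lemma unit_inverse:
  assumes "f \<in> units"
  obtains g where "g \<in> units" "compose S f g = (\<lambda>x\<in>S. x)" "compose S g f = (\<lambda>x\<in>S. x)"
proof
  let ?g = "restrict (inv_into S f) S"
  have b: "f \<in> Bij S" and K: "f \<in> K" "inv_into S f \<in> K" using assms by auto
  have "bij_betw f S S" using b by (simp add: Bij_def)
  then show r: "compose S f ?g = (\<lambda>x\<in>S. x)"
    by (auto simp: compose_def fun_eq_iff bij_betw_def f_inv_into_f)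
  show l: "compose S ?g f = (\<lambda>x\<in>S. x)" using b by (rule Bij_compose_restrict_eq)
  show "?g \<in> units"
    by (rule unitI[OF _ _ K(1) l r]) (auto intro: cong_closed[OF K(2)])
qed

lemma group_UnitGroup: "group UnitGroup"
proof -
  have 1: "compose S f g \<in> units" if f: "f \<in> units" and g: "g \<in> units" for f g
  proof -
    obtain f' where f': "f' \<in> units" "compose S f f' = (\<lambda>x\<in>S. x)" "compose S f' f = (\<lambda>x\<in>S. x)"
      by (rule unit_inverse[OF f])
    obtain g' where g': "g' \<in> units" "compose S g g' = (\<lambda>x\<in>S. x)" "compose S g' g = (\<lambda>x\<in>S. x)"
      by (rule unit_inverse[OF g])
    have m: "h x \<in> S" if "h \<in> units" "x \<in> S" for h x using that maps by auto
    have e: "f (f' x) = x" "f' (f x) = x" "g (g' x) = x" "g' (g x) = x" if "x \<in> S" for x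
      using fun_cong[OF f'(2), of x] fun_cong[OF f'(3), of x] fun_cong[OF g'(2), of x]
        fun_cong[OF g'(3), of x] that by (simp_all add: compose_eq)
    have K: "compose S f g \<in> K" "compose S g' f' \<in> K"
      using f g f'(1) g'(1) by (auto intro: compose_closed)
    show ?thesis
      by (rule unitI[OF K(1) _ K(2)])
        (use m[OF f] m[OF g] m[OF f'(1)] m[OF g'(1)] e in \<open>auto simp: compose_def fun_eq_iff\<close>)
  qed
  have 2: "(\<lambda>x\<in>S. x) \<in> units" 
    by (rule unitI[OF identity _ identity]) (auto simp: compose_def fun_eq_iff)
  show ?thesis
  proof (rule groupI)
    fix f g assume "f \<in> carrier UnitGroup" "g \<in> carrier UnitGroup"
    then show "f \<otimes>\<^bsub>UnitGroup\<^esub> g \<in> carrier UnitGroup"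
      using 1 by (simp add: BijGroup_def)
  next
    show "\<one>\<^bsub>UnitGroup\<^esub> \<in> carrier UnitGroup" using 2 by (simp add: BijGroup_def)
  next
    fix f g h assume "f \<in> carrier UnitGroup" "g \<in> carrier UnitGroup" "h \<in> carrier UnitGroup"
    then show "f \<otimes>\<^bsub>UnitGroup\<^esub> g \<otimes>\<^bsub>UnitGroup\<^esub> h = f \<otimes>\<^bsub>UnitGroup\<^esub> (g \<otimes>\<^bsub>UnitGroup\<^esub> h)"
      using group.is_monoid[OF group_BijGroup, of S, THEN monoid.m_assoc, of f g h]
      by (simp add: BijGroup_def)
  next
    fix f assume "f \<in> carrier UnitGroup"
    then show "\<one>\<^bsub>UnitGroup\<^esub> \<otimes>\<^bsub>UnitGroup\<^esub> f = f"
      using group.is_monoid[OF group_BijGroup, of S, THEN monoid.l_one, of f]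
      by (simp add: BijGroup_def)
  next
    fix f assume f: "f \<in> carrier UnitGroup"
    then have "f \<in> units" by simp
    then obtain g where "g \<in> units" "compose S g f = (\<lambda>x\<in>S. x)" by (rule unit_inverse)
    with f show "\<exists>g\<in>carrier UnitGroup. g \<otimes>\<^bsub>UnitGroup\<^esub> f = \<one>\<^bsub>UnitGroup\<^esub>"
      by (intro bexI[of _ g]) (simp_all add: BijGroup_def)
  qed
qed

text \<open>A multiplicative map from a group into \<open>K\<close> takes invertible values, because the image of
  \<open>inv a\<close> inverts the image of \<open>a\<close>. So neither bijectivity nor the condition on inverses has to be
  checked for the two maps of the exact sequence.\<close>

lemma group_hom_UnitGroup:
  assumes P: "group P"
    and K: "\<And>a. a \<in> carrier P \<Longrightarrow> F a \<in> K \<and> F a \<in> extensional S"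
    and mult: "\<And>a b. \<lbrakk>a \<in> carrier P; b \<in> carrier P\<rbrakk> \<Longrightarrow> F (a \<otimes>\<^bsub>P\<^esub> b) = compose S (F a) (F b)"
    and one: "F \<one>\<^bsub>P\<^esub> = (\<lambda>x\<in>S. x)"
  shows "group_hom P UnitGroup F"
proof -
  interpret P: group P by fact
  have units: "F a \<in> units" if "a \<in> carrier P" for a
    by (rule unitI[of _ "F (inv\<^bsub>P\<^esub> a)"]) (use that K in \<open>simp_all add: one flip: mult\<close>)
  show ?thesis
    unfolding group_hom_def group_hom_axioms_def
    by (intro conjI P group_UnitGroup homI) (use units in \<open>auto simp: BijGroup_def mult\<close>)
qed

end

lemma transformation_monoid_partial_hom:
  assumes "partial_group M"
  shows "transformation_monoid (pcarrier M) (partial_hom M M)"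
proof -
  interpret partial_group M by fact
  have eq: "map f u = map g u" if "u \<in> pdom M" "\<And>x. x \<in> pcarrier M \<Longrightarrow> f x = g x"
    for f g :: "'a \<Rightarrow> 'a" and u
    using that dom_words by (intro map_cong) auto
  show ?thesis
  proof
    fix f assume "f \<in> partial_hom M M"
    then show "f \<in> pcarrier M \<rightarrow> pcarrier M" by (simp add: partial_hom_def)
  next
    show "(\<lambda>x\<in>pcarrier M. x) \<in> partial_hom M M"
      using eq[where f="\<lambda>x\<in>pcarrier M. x" and g=id] prod_closed by (auto simp: partial_hom_def)
  next
    fix f g assume f: "f \<in> partial_hom M M" and g: "g \<in> partial_hom M M"
    have m: "map (compose (pcarrier M) f g) u = map f (map g u)" if "u \<in> pdom M" for u
      using eq[OF that, of "compose (pcarrier M) f g" "f \<circ> g"] by (simp add: compose_def)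
    have "map f (map g u) \<in> pdom M \<and> pprod M (map f (map g u)) = f (g (pprod M u))" if "u \<in> pdom M" for u
      using f g that unfolding partial_hom_def by (simp del: map_map)
    moreover have "compose (pcarrier M) f g \<in> pcarrier M \<rightarrow> pcarrier M"
      using f g by (auto simp: partial_hom_def compose_eq)
    ultimately show "compose (pcarrier M) f g \<in> partial_hom M M"
      using m prod_closed unfolding partial_hom_def by (simp add: compose_eq del: map_map map_eq_conv)
  next
    fix f g assume f: "f \<in> partial_hom M M" and "\<And>x. x \<in> pcarrier M \<Longrightarrow> g x = f x"
    then show "g \<in> partial_hom M M"
      using eq[of _ g f] prod_closed by (auto simp: partial_hom_def simp del: map_eq_conv)
  qed
qed

lemma transformation_monoid_graph_hom: "transformation_monoid V (graph_hom V E V E)"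
  by unfold_locales (auto simp: graph_hom_def compose_def Pi_iff)

section \<open>Torsion in partial groups\<close>

text \<open>A power of an element has to be formed as a single product: without the domain condition, the
  product of the word is meaningless.\<close>

definition torsion :: "'a partial_group \<Rightarrow> 'a \<Rightarrow> bool" where
  "torsion M x \<longleftrightarrow> (\<exists>n>0. replicate n x \<in> pdom M \<and> pprod M (replicate n x) = pprod M [])"

lemma partial_hom_prod:
  assumes "\<phi> \<in> partial_hom M N" "u \<in> pdom M"
  shows "map \<phi> u \<in> pdom N" "pprod N (map \<phi> u) = \<phi> (pprod M u)"
  using assms by (auto simp: partial_hom_def)

lemma (in partial_group) Nil_dom: "[] \<in> pdom M"
  using carrier_nonempty dom_singleton dom_append by (metis append_Nil ex_in_conv)

lemma (in partial_group) torsion_hom: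
  assumes \<phi>: "\<phi> \<in> partial_hom M N" and "torsion M x"
  shows "torsion N (\<phi> x)"
proof -
  obtain n where n: "n > 0" "replicate n x \<in> pdom M" "pprod M (replicate n x) = pprod M []"
    using assms(2) by (auto simp: torsion_def)
  show ?thesis
    unfolding torsion_def
    using n partial_hom_prod[OF \<phi> n(2)] partial_hom_prod[OF \<phi> Nil_dom] by (intro exI[of _ n]) simp
qed

section \<open>Cyclically reduced words\<close>

lemma map_eq_append_infix:
  assumes "map f us = x @ y @ z"
  obtains x' y' z' where "us = x' @ y' @ z'" "y = map f y'"
  using assms by (auto simp: map_eq_append_conv append_eq_map_conv)

lemma reduced_append:
  "reduced (x @ y) \<longleftrightarrow> reduced x \<and> reduced y \<and> (x \<noteq> [] \<and> y \<noteq> [] \<longrightarrow> fst (last x) \<noteq> fst (hd y))"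
  by (auto simp: reduced_def successively_append_iff)

lemma cyclically_reduced_iff:
  "cyclically_reduced w \<longleftrightarrow> reduced w \<and> (length w \<ge> 2 \<longrightarrow> fst (hd w) \<noteq> fst (last w))"
proof
  assume c: "cyclically_reduced w"
  have "fst (hd w) \<noteq> fst (last w)" if l: "length w \<ge> 2"
  proof -
    obtain a y where w: "w = a # y" and y: "y \<noteq> []" using l by (cases w) (auto simp: Suc_le_eq)
    have "reduced (y @ [a])" using c[unfolded cyclically_reduced_def, rule_format, of 1] w by simp
    then show ?thesis using w y by (auto simp: reduced_append)
  qed
  then show "reduced w \<and> (length w \<ge> 2 \<longrightarrow> fst (hd w) \<noteq> fst (last w))"
    using c[unfolded cyclically_reduced_def, rule_format, of 0] by simp
next
  assume r: "reduced w \<and> (length w \<ge> 2 \<longrightarrow> fst (hd w) \<noteq> fst (last w))"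
  show "cyclically_reduced w"
    unfolding cyclically_reduced_def
  proof
    fix n
    define x y where "x = take (n mod length w) w" and "y = drop (n mod length w) w"
    have w: "w = x @ y" by (simp add: x_def y_def)
    have rot: "rotate n w = y @ x" by (simp add: rotate_drop_take x_def y_def)
    show "reduced (rotate n w)"
    proof (cases "x = [] \<or> y = []")
      case False
      then have "length w \<ge> 2" using w by (cases x; cases y) auto
      then have "fst (last y) \<noteq> fst (hd x)" using r w False by auto
      then show ?thesis using r w rot by (simp add: reduced_append)
    qed (use r w rot in auto)
  qed
qed

text \<open>Cutting off the first letter can only fail if the second and the last letter have the same
  vertex. The third letter then has a different vertex than the last one, and cutting off two
  letters works.\<close>

lemma split_cyclically_reduced:
  assumes c: "cyclically_reduced w" and l: "length w \<ge> 2"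
  obtains x y where "w = x @ y" "x \<noteq> []" "y \<noteq> []" "cyclically_reduced x" "cyclically_reduced y"
proof -
  obtain a b z where w: "w = a # b # z" using l by (metis One_nat_def Suc_1 Suc_le_length_iff)
  have r: "reduced w" and ne: "fst a \<noteq> fst (last (b # z))"
    using c w by (auto simp: cyclically_reduced_iff)
  show thesis
  proof (cases "z = [] \<or> fst b \<noteq> fst (last (b # z))")
    case True
    with r w show thesis
      by (intro that[of "[a]" "b # z"]) (auto simp: cyclically_reduced_iff reduced_Cons)
  next
    case False
    then have "fst b = fst (last z)" "z \<noteq> []" "fst b \<noteq> fst (hd z)"
      using r w by (auto simp: reduced_Cons)
    with r w show thesis
      by (intro that[of "[a, b]" z]) (auto simp: cyclically_reduced_iff reduced_Cons)
  qed
qed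

section \<open>Words over the vertex groups\<close>

locale graph_of_vertex_groups =
  fixes V :: "'v set" and E :: "'v set set" and H :: "'v \<Rightarrow> 'h monoid"
  assumes simple: "simple_graph V E"
    and groups: "v \<in> V \<Longrightarrow> group (H v)"
    and finite_groups: "v \<in> V \<Longrightarrow> finite (carrier (H v))"
    and nontrivial: "v \<in> V \<Longrightarrow> carrier (H v) \<noteq> {\<one>\<^bsub>H v\<^esub>}"
begin

abbreviation M :: "('v \<times> 'h) list partial_group" where
  "M \<equiv> graph_partial_group V E H"

sublocale partial_group M
  by (rule partial_group_graph) (rule groups)

sublocale M: transformation_monoid "pcarrier M" "partial_hom M M"
  by (rule transformation_monoid_partial_hom) (rule partial_group_axioms)

sublocale G: transformation_monoid V "graph_hom V E V E"
  by (rule transformation_monoid_graph_hom)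

lemma carrier_iff: "w \<in> pcarrier M \<longleftrightarrow> (\<exists>C. clique V E C \<and> w \<in> CR H C)"
  by (auto simp: graph_partial_group_def clique_partial_group_def)

lemma dom_iff: "us \<in> pdom M \<longleftrightarrow> (\<exists>C. clique V E C \<and> us \<in> CR_dom H C)"
  by (auto simp: graph_partial_group_def clique_partial_group_def)

lemma prod_eq: "pprod M us = reduced_form H (concat us)"
  by (simp add: graph_partial_group_def)

lemma CR_mono: "C \<subseteq> V \<Longrightarrow> w \<in> CR H C \<Longrightarrow> w \<in> lists (letters H V)"
  by (auto simp: CR_def letters_def)

lemma carrier_words: "w \<in> pcarrier M \<Longrightarrow> w \<in> lists (letters H V) \<and> cyclically_reduced w"
  using CR_mono by (auto simp: carrier_iff clique_def CR_def)

lemma reduced_form_eq_foldr: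
  assumes "w \<in> lists (letters H V)"
  shows "reduced_form H w = foldr (letter_mult H) w []"
  unfolding reduced_form_def
  by (rule the1_equality[OF ex1_reduced_form[of V, OF groups assms]])
    (auto simp: foldr_letter_mult_reduced foldr_letter_mult_reduction)

lemma reduced_form_reduced: "w \<in> lists (letters H V) \<Longrightarrow> reduced w \<Longrightarrow> reduced_form H w = w"
  by (rule reduced_form_id[of V, OF groups])

text \<open>With only two entries, the infixes to be checked are the entries themselves and the whole
  word.\<close>

lemma pair_dom:
  assumes "x \<in> CR H C" "y \<in> CR H C" "x @ y \<in> CR H C" and C: "C \<subseteq> V"
  shows "[x, y] \<in> CR_dom H C"
proof -
  have id: "reduced_form H w = w" if "w \<in> CR H C" for w
    using that CR_mono[OF C that] by (intro reduced_form_reduced) (auto simp: CR_def cyclically_reduced_iff)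
  show ?thesis
    using assms(1-3) by (auto simp: CR_dom_iff id append_eq_Cons_conv Cons_eq_append_conv)
qed

section \<open>Torsion elements are letters\<close>

text \<open>The embedding of the vertex group into the partial group. It differs from the singleton words
  only at the identity, which is not a letter.\<close>

definition syllable :: "'v \<Rightarrow> 'h \<Rightarrow> ('v \<times> 'h) list" where
  "syllable v g = (if g = \<one>\<^bsub>H v\<^esub> then [] else [(v, g)])"

lemma syllable_one [simp]: "syllable v \<one>\<^bsub>H v\<^esub> = []"
  by (simp add: syllable_def)

lemma syllable_inject: "syllable v g = syllable v h \<longleftrightarrow> g = h"
  by (auto simp: syllable_def)

lemma syllable_CR: "g \<in> carrier (H v) \<Longrightarrow> v \<in> C \<Longrightarrow> syllable v g \<in> CR H C"
  by (auto simp: syllable_def CR_def letters_def cyclically_reduced_iff reduced_Cons)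

lemma clique_singleton: "v \<in> V \<Longrightarrow> clique V E {v}"
  by (simp add: clique_def)

lemma syllable_carrier: "v \<in> V \<Longrightarrow> g \<in> carrier (H v) \<Longrightarrow> syllable v g \<in> pcarrier M"
  using syllable_CR clique_singleton by (fastforce simp: carrier_iff)

lemma reduced_form_syllables:
  assumes v: "v \<in> V" and gs: "gs \<in> lists (carrier (H v))"
  shows "reduced_form H (concat (map (syllable v) gs)) = syllable v (foldr (\<otimes>\<^bsub>H v\<^esub>) gs \<one>\<^bsub>H v\<^esub>)"
proof -
  interpret group "H v" using v by (rule groups)
  have "concat (map (syllable v) gs) \<in> lists (letters H V)"
    using gs v by (auto simp: syllable_def letters_def)
  moreover have "foldr (letter_mult H) (concat (map (syllable v) gs)) []
      = syllable v (foldr (\<otimes>\<^bsub>H v\<^esub>) gs \<one>\<^bsub>H v\<^esub>) \<and> foldr (\<otimes>\<^bsub>H v\<^esub>) gs \<one>\<^bsub>H v\<^esub> \<in> carrier (H v)"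
    using gs by (induction gs) (auto simp: syllable_def)
  ultimately show ?thesis by (simp add: reduced_form_eq_foldr)
qed

text \<open>Any number of elements of one vertex group multiply to an element of that group, which is
  cyclically reduced as a word; hence no infix leaves the carrier.\<close>

lemma syllables_dom:
  assumes v: "v \<in> V" and gs: "gs \<in> lists (carrier (H v))"
  shows "map (syllable v) gs \<in> pdom M"
proof -
  interpret group "H v" using v by (rule groups)
  have f: "foldr (\<otimes>\<^bsub>H v\<^esub>) hs \<one>\<^bsub>H v\<^esub> \<in> carrier (H v)" if "hs \<in> lists (carrier (H v))" for hs
    using that by (induction hs) auto
  have "map (syllable v) gs \<in> CR_dom H {v}"
    unfolding CR_dom_iff
  proof (intro conjI allI impI)
    show "map (syllable v) gs \<in> lists (CR H {v})" using gs syllable_CR by fastforce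
  next
    fix x y z assume "map (syllable v) gs = x @ y @ z \<and> y \<noteq> []"
    then obtain us hs vs where "gs = us @ hs @ vs" "y = map (syllable v) hs"
      using map_eq_append_infix by blast
    with gs have "hs \<in> lists (carrier (H v))" "y = map (syllable v) hs" by auto
    then show "reduced_form H (concat y) \<in> CR H {v}"
      using v f syllable_CR by (simp add: reduced_form_syllables)
  qed
  then show ?thesis using clique_singleton[OF v] by (auto simp: dom_iff)
qed

lemma carrier_syllable:
  assumes "x \<in> pcarrier M" "length x \<le> 1"
  obtains "x = []" | v g where "v \<in> V" "g \<in> carrier (H v)" "g \<noteq> \<one>\<^bsub>H v\<^esub>" "x = [(v, g)]"
  using carrier_words[OF assms(1)] assms(2) by (cases x) (auto simp: letters_def)

text \<open>Being reduced is needed inside a copy of the word, being cyclically reduced where two copies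
  meet.\<close>

lemma reduced_power:
  assumes "cyclically_reduced x" "length x \<ge> 2"
  shows "reduced (concat (replicate n x))"
proof (induction n)
  case (Suc n)
  then show ?case
    using assms by (cases n) (auto simp: reduced_append cyclically_reduced_iff)
qed simp

lemma torsion_iff:
  assumes x: "x \<in> pcarrier M"
  shows "torsion M x \<longleftrightarrow> length x \<le> 1"
proof
  assume "torsion M x"
  then obtain n where n: "n > 0" "reduced_form H (concat (replicate n x)) = reduced_form H []"
    by (auto simp: torsion_def prod_eq)
  have w: "x \<in> lists (letters H V)" "cyclically_reduced x" using carrier_words[OF x] by auto
  show "length x \<le> 1"
  proof (rule ccontr)
    assume l: "\<not> length x \<le> 1"
    have "concat (replicate n x) \<in> lists (letters H V)" using w(1) by auto
    then have "concat (replicate n x) = []"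
      using n(2) l reduced_power[OF w(2), of n] by (simp add: reduced_form_reduced)
    then show False using n(1) l by simp
  qed
next
  assume "length x \<le> 1"
  with x show "torsion M x"
  proof (cases rule: carrier_syllable)
    case 1
    then show ?thesis using dom_singleton[OF x] by (auto simp: torsion_def prod_eq intro!: exI[of _ 1])
  next
    case (2 v g)
    interpret group "H v" using 2(1) by (rule groups)
    \<comment> \<open>By Lagrange, the group order kills every element; it need not be the order of \<open>g\<close>.\<close>
    define n where "n = order (H v)"
    have n: "n > 0" using finite_groups[OF 2(1)] by (auto simp: n_def order_gt_0_iff_finite)
    have f: "foldr (\<otimes>\<^bsub>H v\<^esub>) (replicate m g) \<one>\<^bsub>H v\<^esub> = g [^]\<^bsub>H v\<^esub> m" for m
      using 2(2) by (induction m) (simp, subst nat_pow_Suc2, simp_all)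
    have r: "replicate n x = map (syllable v) (replicate n g)"
      using 2(3,4) by (simp add: syllable_def)
    have gs: "replicate n g \<in> lists (carrier (H v))" using 2(2) by auto
    have "pprod M (replicate n x) = syllable v (g [^]\<^bsub>H v\<^esub> n)"
      unfolding r prod_eq by (simp only: reduced_form_syllables[OF 2(1) gs] f)
    also have "\<dots> = pprod M []"
      using 2(2) pow_order_eq_1[of g] by (simp add: n_def prod_eq reduced_form_reduced)
    finally show ?thesis
      using n syllables_dom[OF 2(1) gs] r by (auto simp: torsion_def)
  qed
qed

section \<open>Adjacency in terms of products of letters\<close>

text \<open>These characterizations only mention the domain, the product and torsion, all of which are
  preserved by automorphisms of the partial group.\<close>

lemma letters_relation:
  assumes u: "u \<in> V" "g \<in> carrier (H u)" "g \<noteq> \<one>\<^bsub>H u\<^esub>" and v: "v \<in> V" "h \<in> carrier (H v)" "h \<noteq> \<one>\<^bsub>H v\<^esub>"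
  shows same_vertex: "u = v \<longleftrightarrow> [[(u, g)], [(v, h)]] \<in> pdom M \<and> torsion M (pprod M [[(u, g)], [(v, h)]])"
    and edge: "{u, v} \<in> E \<longleftrightarrow> [[(u, g)], [(v, h)]] \<in> pdom M \<and> \<not> torsion M (pprod M [[(u, g)], [(v, h)]])"
proof -
  let ?us = "[[(u, g)], [(v, h)]]"
  \<comment> \<open>There are no loops: \<open>{v, v}\<close> has one element. This makes the two cases exclusive.\<close>
  have loop: "{u, v} \<notin> E" if "u = v" using simple that by (auto simp: simple_graph_def)
  have dom: "u = v \<or> {u, v} \<in> E" if "?us \<in> pdom M"
    using that by (auto simp: dom_iff CR_dom_def CR_def letters_def clique_def)
  have same: "?us \<in> pdom M \<and> torsion M (pprod M ?us)" if [simp]: "u = v"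
  proof -
    interpret group "H v" using v(1) by (rule groups)
    have us: "?us = map (syllable v) [g, h]" using u v by (simp add: syllable_def)
    have gs: "[g, h] \<in> lists (carrier (H v))" using u v by simp
    have d: "?us \<in> pdom M" unfolding us by (rule syllables_dom[OF v(1) gs])
    have "length (pprod M ?us) \<le> 1"
      unfolding us prod_eq reduced_form_syllables[OF v(1) gs] by (simp add: syllable_def)
    then show ?thesis using d torsion_iff[OF prod_closed[OF d]] by simp
  qed
  have adjacent: "?us \<in> pdom M \<and> \<not> torsion M (pprod M ?us)" if e: "{u, v} \<in> E"
  proof -
    have ne: "u \<noteq> v" using loop e by blast
    have C: "clique V E {u, v}" using u v e by (auto simp: clique_def insert_commute)
    have l: "(u, g) \<in> letters H {u, v}" "(v, h) \<in> letters H {u, v}" using u v by (auto simp: letters_def)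
    have "?us \<in> CR_dom H {u, v}"
      by (rule pair_dom) (use l ne u v in \<open>auto simp: CR_def cyclically_reduced_iff reduced_Cons\<close>)
    then have d: "?us \<in> pdom M" using C by (auto simp: dom_iff)
    have "reduced_form H [(u, g), (v, h)] = [(u, g), (v, h)]"
      using u v ne by (intro reduced_form_reduced) (auto simp: letters_def reduced_Cons)
    then show ?thesis using d torsion_iff[OF prod_closed[OF d]] by (simp add: prod_eq)
  qed
  show "u = v \<longleftrightarrow> ?us \<in> pdom M \<and> torsion M (pprod M ?us)"
    and "{u, v} \<in> E \<longleftrightarrow> ?us \<in> pdom M \<and> \<not> torsion M (pprod M ?us)"
    using dom same adjacent loop by blast+
qed

section \<open>Homomorphisms are determined by their values on letters\<close>

text \<open>A word that is not a letter is the product of two shorter words in the domain, to which the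
  induction hypothesis applies.\<close>

lemma hom_eq_if_eq_on_letters:
  assumes \<phi>: "\<phi> \<in> partial_hom M N" and \<psi>: "\<psi> \<in> partial_hom M N"
    and letters: "\<And>x. x \<in> pcarrier M \<Longrightarrow> length x \<le> 1 \<Longrightarrow> \<phi> x = \<psi> x"
    and w: "w \<in> pcarrier M"
  shows "\<phi> w = \<psi> w"
  using w
proof (induction w rule: length_induct)
  case (1 w)
  show ?case
  proof (cases "length w \<le> 1")
    case False
    obtain C where C: "clique V E C" "w \<in> CR H C" using 1(2) by (auto simp: carrier_iff)
    then have V: "C \<subseteq> V" by (simp add: clique_def)
    have "cyclically_reduced w" using C by (simp add: CR_def)
    then obtain x y where s: "w = x @ y" "x \<noteq> []" "y \<noteq> []" "cyclically_reduced x" "cyclically_reduced y"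
      using False split_cyclically_reduced[of w] by auto
    then have xy: "x \<in> CR H C" "y \<in> CR H C" using C(2) by (auto simp: CR_def)
    then have d: "[x, y] \<in> pdom M" using C s(1) pair_dom V by (auto simp: dom_iff)
    have p: "pprod M [x, y] = w"
      using s(1) CR_mono[OF V C(2)] C(2)
      by (simp add: prod_eq reduced_form_reduced CR_def cyclically_reduced_iff)
    have "x \<in> pcarrier M" "y \<in> pcarrier M" using xy C(1) by (auto simp: carrier_iff)
    then have "\<phi> x = \<psi> x" "\<phi> y = \<psi> y" using 1(1) s(1-3) by simp_all
    moreover have "\<phi> w = pprod N [\<phi> x, \<phi> y]" "\<psi> w = pprod N [\<psi> x, \<psi> y]"
      using partial_hom_prod(2)[OF \<phi> d] partial_hom_prod(2)[OF \<psi> d] p by simp_all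
    ultimately show ?thesis by simp
  qed (use letters 1 in blast)
qed

section \<open>Letterwise automorphisms\<close>

definition letterwise :: "('v \<Rightarrow> 'h \<Rightarrow> 'h) \<Rightarrow> ('v \<times> 'h) list \<Rightarrow> ('v \<times> 'h) list" where
  "letterwise a = (\<lambda>w\<in>pcarrier M. map (\<lambda>(v, g). (v, a v g)) w)"

abbreviation Autos :: "('v \<Rightarrow> 'h \<Rightarrow> 'h) monoid" where
  "Autos \<equiv> product_group V (\<lambda>v. AutoGroup (H v))"

(* Unfolding the product group would hide the membership in Autos. *)
declare carrier_product_group [simp del] mult_product_group [simp del] one_product_group [simp del]

lemma Autos_mem: "a \<in> carrier Autos \<longleftrightarrow> a \<in> extensional V \<and> (\<forall>v\<in>V. a v \<in> auto (H v))"
  by (auto simp: AutoGroup_def carrier_product_group PiE_iff)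

lemma group_Autos: "group Autos"
  by (rule product_group) (rule group.AutoGroup[OF groups])

lemma auto_props:
  assumes "v \<in> V" "f \<in> auto (H v)"
  shows "f \<one>\<^bsub>H v\<^esub> = \<one>\<^bsub>H v\<^esub>"
    and "g \<in> carrier (H v) \<Longrightarrow> f g \<in> carrier (H v)"
    and "g \<in> carrier (H v) \<Longrightarrow> f g = \<one>\<^bsub>H v\<^esub> \<longleftrightarrow> g = \<one>\<^bsub>H v\<^esub>"
    and "g \<in> carrier (H v) \<Longrightarrow> h \<in> carrier (H v) \<Longrightarrow> f (g \<otimes>\<^bsub>H v\<^esub> h) = f g \<otimes>\<^bsub>H v\<^esub> f h"
proof -
  interpret group "H v" using assms(1) by (rule groups)
  have h: "f \<in> hom (H v) (H v)" and b: "bij_betw f (carrier (H v)) (carrier (H v))"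
    using assms(2) by (auto simp: auto_def Bij_def)
  show 1: "f \<one>\<^bsub>H v\<^esub> = \<one>\<^bsub>H v\<^esub>" using hom_one[OF h] is_group by blast
  show "f g \<in> carrier (H v)" if "g \<in> carrier (H v)" using h that by (rule hom_in_carrier)
  show "f g = \<one>\<^bsub>H v\<^esub> \<longleftrightarrow> g = \<one>\<^bsub>H v\<^esub>" if "g \<in> carrier (H v)"
    using inj_on_eq_iff[OF bij_betw_imp_inj_on[OF b] that one_closed] 1 by simp
  show "f (g \<otimes>\<^bsub>H v\<^esub> h) = f g \<otimes>\<^bsub>H v\<^esub> f h" if "g \<in> carrier (H v)" "h \<in> carrier (H v)"
    using h that by (rule hom_mult)
qed

context
  fixes a :: "'v \<Rightarrow> 'h \<Rightarrow> 'h"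
  assumes a: "\<And>v. v \<in> V \<Longrightarrow> a v \<in> auto (H v)"
begin

abbreviation relabel where "relabel \<equiv> map (\<lambda>(v, g). (v, a v g))"

lemma relabel_letters: "C \<subseteq> V \<Longrightarrow> w \<in> lists (letters H C) \<Longrightarrow> relabel w \<in> lists (letters H C)"
  using auto_props(2,3)[OF _ a] by (fastforce simp: letters_def)

lemma relabel_reduced: "reduced (relabel w) \<longleftrightarrow> reduced w"
  by (simp add: reduced_def successively_map case_prod_beta)

lemma relabel_CR:
  assumes "C \<subseteq> V" "w \<in> CR H C" shows "relabel w \<in> CR H C"
  using assms relabel_letters[of C w]
  by (simp add: CR_def cyclically_reduced_def relabel_reduced rotate_map)

text \<open>Injectivity of \<open>a v\<close> guarantees that a product of two letters that does not cancel still does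
  not cancel after relabelling.\<close>

lemma relabel_reduction:
  assumes "reduction H w w'" "w \<in> lists (letters H V)"
  shows "reduction H (relabel w) (relabel w')"
  using assms
proof (induction rule: reduction.induct)
  case (cancel v g h x y)
  then have "v \<in> V" "g \<in> carrier (H v)" "h \<in> carrier (H v)" by (auto simp: letters_def)
  then have "a v g \<otimes>\<^bsub>H v\<^esub> a v h = \<one>\<^bsub>H v\<^esub>"
    using auto_props(4)[OF _ a] auto_props(1)[OF _ a] cancel(1) by metis
  then show ?case using reduction.cancel[of H v "a v g" "a v h" "relabel x" "relabel y"] by simp
next
  case (combine v g h x y)
  then have v: "v \<in> V" "g \<in> carrier (H v)" "h \<in> carrier (H v)" by (auto simp: letters_def)
  then interpret group "H v" using groups by blast
  have "a v (g \<otimes>\<^bsub>H v\<^esub> h) = a v g \<otimes>\<^bsub>H v\<^esub> a v h" using auto_props(4)[OF _ a] v by blast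
  moreover have "a v (g \<otimes>\<^bsub>H v\<^esub> h) \<noteq> \<one>\<^bsub>H v\<^esub>" using auto_props(3)[OF _ a] v combine(1) m_closed by blast
  ultimately show ?case using reduction.combine[of H v "a v g" "a v h" "relabel x" "relabel y"] by simp
qed

text \<open>Relabelling a chain of reduction steps gives such a chain, ending in a reduced word; by
  uniqueness of the reduced form this word is the reduced form.\<close>

lemma relabel_reduced_form:
  assumes w: "w \<in> lists (letters H V)"
  shows "reduced_form H (relabel w) = relabel (reduced_form H w)"
proof -
  have map: "(reduction H)\<^sup>*\<^sup>* (relabel w) (relabel w')" if "(reduction H)\<^sup>*\<^sup>* w w'" for w'
    using that
  proof (induction rule: rtranclp_induct)
    case (step y z)
    have "y \<in> lists (letters H V)" by (rule reductions_in[OF groups step(1) w])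
    then show ?case using relabel_reduction[OF step(2)] step(3) by simp
  qed simp
  note p = reduced_form_props[of V H, OF groups w]
  have "reduced_form H (relabel w) = reduced_form H (relabel (reduced_form H w))"
    by (rule reduced_form_eqI[of V, OF groups relabel_letters[OF order_refl w] map[OF p(1)]])
  also have "\<dots> = relabel (reduced_form H w)"
    by (rule reduced_form_reduced) (simp_all add: relabel_letters p relabel_reduced del: in_lists_conv_set)
  finally show ?thesis .
qed

lemma letterwise_hom: "letterwise a \<in> partial_hom M M"
proof -
  have c: "relabel w \<in> pcarrier M" if "w \<in> pcarrier M" for w
    using that relabel_CR by (auto simp: carrier_iff clique_def)
  have "map relabel us \<in> pdom M \<and> pprod M (map relabel us) = relabel (pprod M us)" if us: "us \<in> pdom M" for us
  proof
    obtain C where C: "clique V E C" "us \<in> CR_dom H C" using us by (auto simp: dom_iff)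
    have V: "C \<subseteq> V" using C by (simp add: clique_def)
    have l: "us \<in> lists (CR H C)" using C by (simp add: CR_dom_def)
    have eq: "reduced_form H (concat (map relabel vs)) = relabel (reduced_form H (concat vs))"
      if "vs \<in> lists (CR H C)" for vs
    proof -
      have "concat vs \<in> lists (letters H V)" using that CR_mono[OF V] by fastforce
      then show ?thesis by (simp add: map_concat flip: relabel_reduced_form)
    qed
    have "map relabel us \<in> CR_dom H C"
      unfolding CR_dom_iff
    proof (intro conjI allI impI)
      show "map relabel us \<in> lists (CR H C)" using l relabel_CR[OF V] by auto
      fix x y z assume xyz: "map relabel us = x @ y @ z \<and> y \<noteq> []"
      then obtain x' y' z' where *: "us = x' @ y' @ z'" "y = map relabel y'"
        using map_eq_append_infix by blast
      with xyz have "reduced_form H (concat y') \<in> CR H C" using C(2) unfolding CR_dom_iff by blast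
      then show "reduced_form H (concat y) \<in> CR H C" using eq[of y'] l * relabel_CR[OF V] by simp
    qed
    then show "map relabel us \<in> pdom M" using C by (auto simp: dom_iff)
    show "pprod M (map relabel us) = relabel (pprod M us)" using eq[OF l] by (simp add: prod_eq)
  qed
  then have "relabel \<in> partial_hom M M" using c by (auto simp: partial_hom_def)
  then show ?thesis by (rule M.cong_closed) (simp add: letterwise_def)
qed

end

lemma letterwise_syllable:
  assumes v: "v \<in> V" and a: "a v \<in> auto (H v)" and g: "g \<in> carrier (H v)"
  shows "letterwise a (syllable v g) = syllable v (a v g)"
  using syllable_carrier[OF v g] auto_props(1,3)[OF v a] g by (simp add: letterwise_def syllable_def)

lemma group_hom_letterwise: "group_hom Autos (partial_AutGroup M) letterwise"
  unfolding partial_AutGroup_def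
proof (rule M.group_hom_UnitGroup[OF group_Autos])
  fix a assume "a \<in> carrier Autos"
  then show "letterwise a \<in> partial_hom M M \<and> letterwise a \<in> extensional (pcarrier M)"
    using letterwise_hom[of a] by (auto simp: Autos_mem letterwise_def)
next
  fix a b assume a: "a \<in> carrier Autos" and b: "b \<in> carrier Autos"
  have bc: "letterwise b w \<in> pcarrier M" if "w \<in> pcarrier M" for w
    using M.maps[OF letterwise_hom[of b]] b that by (auto simp: Autos_mem)
  have "(a \<otimes>\<^bsub>Autos\<^esub> b) v g = a v (b v g)" if "(v, g) \<in> letters H V" for v g
    using that a[unfolded Autos_mem] b[unfolded Autos_mem] by (simp add: mult_product_group AutoGroup_def BijGroup_def auto_def letters_def compose_eq)
  then have "map (\<lambda>(v, g). (v, (a \<otimes>\<^bsub>Autos\<^esub> b) v g)) w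
      = map (\<lambda>(v, g). (v, a v g)) (map (\<lambda>(v, g). (v, b v g)) w)" if "w \<in> pcarrier M" for w
    using carrier_words[OF that] by auto
  then show "letterwise (a \<otimes>\<^bsub>Autos\<^esub> b) = compose (pcarrier M) (letterwise a) (letterwise b)"
    using bc by (auto simp: fun_eq_iff compose_def letterwise_def)
next
  have "\<one>\<^bsub>Autos\<^esub> v g = g" if "(v, g) \<in> letters H V" for v g
    using that by (simp add: one_product_group AutoGroup_def BijGroup_def letters_def)
  then have "map (\<lambda>(v, g). (v, \<one>\<^bsub>Autos\<^esub> v g)) w = w" if "w \<in> pcarrier M" for w
    using carrier_words[OF that] by (intro map_idI) auto
  then show "letterwise \<one>\<^bsub>Autos\<^esub> = (\<lambda>w\<in>pcarrier M. w)"
    by (auto simp: fun_eq_iff letterwise_def)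
qed

lemma kernel_letterwise: "kernel Autos (partial_AutGroup M) letterwise = {\<one>\<^bsub>Autos\<^esub>}"
proof -
  interpret group_hom Autos "partial_AutGroup M" letterwise by (rule group_hom_letterwise)
  have "inj_on letterwise (carrier Autos)"
  proof (rule inj_onI)
    fix a b assume a: "a \<in> carrier Autos" and b: "b \<in> carrier Autos" and eq: "letterwise a = letterwise b"
    have ab: "a v \<in> auto (H v)" "b v \<in> auto (H v)" if "v \<in> V" for v using a b that by (auto simp: Autos_mem)
    have "a v g = b v g" if "v \<in> V" "g \<in> carrier (H v)" for v g
      using letterwise_syllable[of v a g] letterwise_syllable[of v b g] ab[of v] that eq by (simp add: syllable_inject)
    then have "a v = b v" if "v \<in> V" for v
      using ab[OF that] that by (intro extensionalityI[of _ "carrier (H v)"]) (auto simp: auto_def Bij_def)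
    then show "a = b" using a b by (intro extensionalityI[of _ V]) (auto simp: Autos_mem)
  qed
  then show ?thesis by (simp only: inj_iff_trivial_ker)
qed

section \<open>The action on vertices\<close>

text \<open>The vertex \<open>v\<close> is sent to the vertex of the image of a letter at \<open>v\<close>. The letter is chosen
  arbitrarily; that the choice does not matter is shown in \<open>aut_letter\<close> below.\<close>

definition vertex_map :: "(('v \<times> 'h) list \<Rightarrow> ('v \<times> 'h) list) \<Rightarrow> 'v \<Rightarrow> 'v" where
  "vertex_map \<phi> = (\<lambda>v\<in>V. fst (hd (\<phi> [(v, SOME g. g \<in> carrier (H v) \<and> g \<noteq> \<one>\<^bsub>H v\<^esub>)])))"

lemma nontrivial_element: "v \<in> V \<Longrightarrow> \<exists>g. g \<in> carrier (H v) \<and> g \<noteq> \<one>\<^bsub>H v\<^esub>"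
  using nontrivial[of v] group.is_monoid[OF groups, of v, THEN monoid.one_closed] by blast

lemma letter_carrier: "v \<in> V \<Longrightarrow> g \<in> carrier (H v) \<Longrightarrow> g \<noteq> \<one>\<^bsub>H v\<^esub> \<Longrightarrow> [(v, g)] \<in> pcarrier M"
  using syllable_carrier[of v g] by (simp add: syllable_def)

context
  fixes \<phi> assumes \<phi>: "\<phi> \<in> M.units"
begin

lemma aut_hom: "\<phi> \<in> partial_hom M M" and aut_inj: "inj_on \<phi> (pcarrier M)"
  using \<phi> by (auto simp: Bij_def bij_betw_def)

lemma aut_Nil: "\<phi> [] = []"
  using partial_hom_prod(2)[OF aut_hom Nil_dom] by (simp add: prod_eq reduced_form_reduced)

lemma aut_torsion:
  assumes x: "x \<in> pcarrier M" shows "torsion M (\<phi> x) \<longleftrightarrow> torsion M x"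
proof
  obtain \<psi> where \<psi>: "\<psi> \<in> M.units" "compose (pcarrier M) \<psi> \<phi> = (\<lambda>x\<in>pcarrier M. x)"
    by (rule M.unit_inverse[OF \<phi>])
  assume "torsion M (\<phi> x)"
  then have "torsion M (\<psi> (\<phi> x))" using \<psi>(1) torsion_hom by blast
  then show "torsion M x" using fun_cong[OF \<psi>(2), of x] x by (simp add: compose_eq)
qed (rule torsion_hom[OF aut_hom])

lemma aut_letter_exists:
  assumes v: "v \<in> V" "g \<in> carrier (H v)" "g \<noteq> \<one>\<^bsub>H v\<^esub>"
  obtains v' g' where "\<phi> [(v, g)] = [(v', g')]" "v' \<in> V" "g' \<in> carrier (H v')" "g' \<noteq> \<one>\<^bsub>H v'\<^esub>"
proof -
  have c: "[(v, g)] \<in> pcarrier M" using v by (rule letter_carrier)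
  then have c': "\<phi> [(v, g)] \<in> pcarrier M" using M.maps[OF aut_hom] by blast
  have l: "length (\<phi> [(v, g)]) \<le> 1" using aut_torsion[OF c] torsion_iff[OF c] torsion_iff[OF c'] by simp
  have "[] \<in> pcarrier M" using prod_closed[OF Nil_dom] by (simp add: prod_eq reduced_form_reduced)
  then have "\<phi> [(v, g)] \<noteq> []" using inj_on_eq_iff[OF aut_inj c, of "[]"] aut_Nil by simp
  with c' l that show thesis by (cases rule: carrier_syllable) auto
qed

lemma aut_pair:
  assumes "[x, y] \<in> pdom M"
  shows "[\<phi> x, \<phi> y] \<in> pdom M" "torsion M (pprod M [\<phi> x, \<phi> y]) \<longleftrightarrow> torsion M (pprod M [x, y])"
  using partial_hom_prod[OF aut_hom assms] aut_torsion[OF prod_closed[OF assms]] by simp_all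

text \<open>Two letters at \<open>v\<close> have images at the same vertex, by \<open>same_vertex\<close> for both pairs.\<close>

lemma aut_letter:
  assumes v: "v \<in> V" "g \<in> carrier (H v)" "g \<noteq> \<one>\<^bsub>H v\<^esub>"
  obtains g' where "\<phi> [(v, g)] = [(vertex_map \<phi> v, g')]" "vertex_map \<phi> v \<in> V"
    "g' \<in> carrier (H (vertex_map \<phi> v))" "g' \<noteq> \<one>\<^bsub>H (vertex_map \<phi> v)\<^esub>"
proof -
  define c where "c = (SOME g. g \<in> carrier (H v) \<and> g \<noteq> \<one>\<^bsub>H v\<^esub>)"
  have c: "c \<in> carrier (H v)" "c \<noteq> \<one>\<^bsub>H v\<^esub>"
    unfolding c_def using someI_ex[OF nontrivial_element[OF v(1)]] by auto
  obtain u h where u: "\<phi> [(v, c)] = [(u, h)]" "u \<in> V" "h \<in> carrier (H u)" "h \<noteq> \<one>\<^bsub>H u\<^esub>"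
    using aut_letter_exists[OF v(1) c] .
  obtain u' h' where u': "\<phi> [(v, g)] = [(u', h')]" "u' \<in> V" "h' \<in> carrier (H u')" "h' \<noteq> \<one>\<^bsub>H u'\<^esub>"
    using aut_letter_exists[OF v] .
  have "u = u'"
    using aut_pair[of "[(v, c)]" "[(v, g)]"] same_vertex[OF v(1) c v] same_vertex[OF u(2-4) u'(2-4)] u(1) u'(1)
    by simp
  moreover have "vertex_map \<phi> v = u" using v(1) u(1) by (simp add: vertex_map_def c_def)
  ultimately show thesis using u' that by simp
qed

lemma vertex_map_graph_hom: "vertex_map \<phi> \<in> graph_hom V E V E"
  unfolding graph_hom_def
proof (intro CollectI conjI ballI impI Pi_I)
  fix v assume "v \<in> V"
  moreover obtain g where "g \<in> carrier (H v)" "g \<noteq> \<one>\<^bsub>H v\<^esub>"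
    using nontrivial_element \<open>v \<in> V\<close> by blast
  ultimately obtain g' where "vertex_map \<phi> v \<in> V" by (rule aut_letter)
  then show "vertex_map \<phi> v \<in> V" .
next
  fix u v assume u: "u \<in> V" and v: "v \<in> V" and e: "{u, v} \<in> E"
  obtain g h where g: "g \<in> carrier (H u)" "g \<noteq> \<one>\<^bsub>H u\<^esub>" and h: "h \<in> carrier (H v)" "h \<noteq> \<one>\<^bsub>H v\<^esub>"
    using nontrivial_element u v by blast
  obtain g' where g': "\<phi> [(u, g)] = [(vertex_map \<phi> u, g')]" "vertex_map \<phi> u \<in> V"
    "g' \<in> carrier (H (vertex_map \<phi> u))" "g' \<noteq> \<one>\<^bsub>H (vertex_map \<phi> u)\<^esub>" using aut_letter[OF u g] .
  obtain h' where h': "\<phi> [(v, h)] = [(vertex_map \<phi> v, h')]" "vertex_map \<phi> v \<in> V"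
    "h' \<in> carrier (H (vertex_map \<phi> v))" "h' \<noteq> \<one>\<^bsub>H (vertex_map \<phi> v)\<^esub>" using aut_letter[OF v h] .
  show "{vertex_map \<phi> u, vertex_map \<phi> v} \<in> E"
    using e aut_pair[of "[(u, g)]" "[(v, h)]"] edge[OF u g v h] edge[OF g'(2-4) h'(2-4)] g'(1) h'(1)
    by simp
qed

end

lemma vertex_map_eqI:
  assumes "\<phi> \<in> M.units" "v \<in> V" "g \<in> carrier (H v)" "g \<noteq> \<one>\<^bsub>H v\<^esub>" "\<phi> [(v, g)] = [(u, h)]"
  shows "vertex_map \<phi> v = u"
  using aut_letter[OF assms(1-4)] assms(5) by (metis Pair_inject list.inject)

lemma group_hom_vertex_map: "group_hom (partial_AutGroup M) (graph_AutGroup V E) vertex_map"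
  unfolding graph_AutGroup_def
proof (rule G.group_hom_UnitGroup)
  show "group (partial_AutGroup M)" unfolding partial_AutGroup_def by (rule M.group_UnitGroup)
next
  fix \<phi> assume "\<phi> \<in> carrier (partial_AutGroup M)"
  then show "vertex_map \<phi> \<in> graph_hom V E V E \<and> vertex_map \<phi> \<in> extensional V"
    using vertex_map_graph_hom[of \<phi>] by (simp add: partial_AutGroup_def vertex_map_def)
next
  fix \<phi> \<psi> assume "\<phi> \<in> carrier (partial_AutGroup M)" "\<psi> \<in> carrier (partial_AutGroup M)"
  then have \<phi>: "\<phi> \<in> M.units" and \<psi>: "\<psi> \<in> M.units" by (auto simp: partial_AutGroup_def)
  have m: "\<phi> \<otimes>\<^bsub>partial_AutGroup M\<^esub> \<psi> = compose (pcarrier M) \<phi> \<psi>"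
    using \<phi> \<psi> by (simp add: partial_AutGroup_def BijGroup_def)
  have u: "compose (pcarrier M) \<phi> \<psi> \<in> M.units"
    using monoid.m_closed[OF group.is_monoid[OF M.group_UnitGroup], of \<phi> \<psi>] \<phi> \<psi>
    by (simp add: BijGroup_def)
  have "vertex_map (compose (pcarrier M) \<phi> \<psi>) v = vertex_map \<phi> (vertex_map \<psi> v)" if v: "v \<in> V" for v
  proof -
    obtain g where g: "g \<in> carrier (H v)" "g \<noteq> \<one>\<^bsub>H v\<^esub>" using nontrivial_element[OF v] by blast
    obtain g' where g': "\<psi> [(v, g)] = [(vertex_map \<psi> v, g')]" "vertex_map \<psi> v \<in> V"
      "g' \<in> carrier (H (vertex_map \<psi> v))" "g' \<noteq> \<one>\<^bsub>H (vertex_map \<psi> v)\<^esub>" using aut_letter[OF \<psi> v g] .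
    obtain g'' where "\<phi> [(vertex_map \<psi> v, g')] = [(vertex_map \<phi> (vertex_map \<psi> v), g'')]"
      using aut_letter[OF \<phi> g'(2-4)] .
    then show ?thesis
      using g'(1) letter_carrier[OF v g] by (intro vertex_map_eqI[OF u v g]) (simp add: compose_eq)
  qed
  then show "vertex_map (\<phi> \<otimes>\<^bsub>partial_AutGroup M\<^esub> \<psi>) = compose V (vertex_map \<phi>) (vertex_map \<psi>)"
    unfolding m by (auto simp: fun_eq_iff compose_def vertex_map_def)
next
  have u: "(\<lambda>x\<in>pcarrier M. x) \<in> M.units"
    using monoid.one_closed[OF group.is_monoid[OF M.group_UnitGroup]] by (simp add: BijGroup_def)
  have "vertex_map (\<lambda>x\<in>pcarrier M. x) v = v" if v: "v \<in> V" for v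
  proof -
    obtain g where g: "g \<in> carrier (H v)" "g \<noteq> \<one>\<^bsub>H v\<^esub>" using nontrivial_element[OF v] by blast
    show ?thesis using letter_carrier[OF v g] by (intro vertex_map_eqI[OF u v g]) simp
  qed
  then show "vertex_map \<one>\<^bsub>partial_AutGroup M\<^esub> = (\<lambda>x\<in>V. x)"
    by (auto simp: partial_AutGroup_def BijGroup_def fun_eq_iff) (simp add: vertex_map_def)
qed

text \<open>On the letters of each vertex, \<open>\<phi>\<close> is an injective endomorphism of a finite group, hence an
  automorphism. So \<open>\<phi>\<close> agrees with a letterwise map on letters, and then everywhere.\<close>

lemma fixing_vertices_letterwise:
  assumes \<phi>: "\<phi> \<in> M.units" and fixed: "\<And>v. v \<in> V \<Longrightarrow> vertex_map \<phi> v = v"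
  obtains a where "a \<in> carrier Autos" "\<phi> = letterwise a"
proof -
  note hom = aut_hom[OF \<phi>]
  have "\<exists>g'\<in>carrier (H v). \<phi> (syllable v g) = syllable v g'" if v: "v \<in> V" and g: "g \<in> carrier (H v)" for v g
  proof (cases "g = \<one>\<^bsub>H v\<^esub>")
    case True
    then show ?thesis using g aut_Nil[OF \<phi>] by (intro bexI[of _ g]) (simp_all add: syllable_def)
  next
    case False
    obtain g' where "\<phi> [(v, g)] = [(v, g')]" "g' \<in> carrier (H v)" "g' \<noteq> \<one>\<^bsub>H v\<^esub>"
      by (rule aut_letter[OF \<phi> v g False]) (simp add: fixed[OF v])
    with False show ?thesis by (intro bexI[of _ g']) (simp_all add: syllable_def)
  qed
  note ex = this
  define a where "a = (\<lambda>v\<in>V. \<lambda>g\<in>carrier (H v).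
    SOME g'. g' \<in> carrier (H v) \<and> \<phi> (syllable v g) = syllable v g')"
  have a: "a v g \<in> carrier (H v)" "\<phi> (syllable v g) = syllable v (a v g)"
    if "v \<in> V" "g \<in> carrier (H v)" for v g
    using someI_ex[OF ex[OF that, unfolded Bex_def]] that by (simp_all add: a_def)
  have auto: "a v \<in> auto (H v)" if v: "v \<in> V" for v
  proof -
    interpret group "H v" using v by (rule groups)
    have inj: "inj_on (a v) (carrier (H v))"
    proof (rule inj_onI)
      fix g h assume g: "g \<in> carrier (H v)" and h: "h \<in> carrier (H v)" and "a v g = a v h"
      then have "\<phi> (syllable v g) = \<phi> (syllable v h)" using a(2)[OF v] g h by simp
      then have "syllable v g = syllable v h"
        using syllable_carrier[OF v g] syllable_carrier[OF v h] by (rule inj_onD[OF aut_inj[OF \<phi>]])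
      then show "g = h" by (simp add: syllable_inject)
    qed
    have "a v (g \<otimes>\<^bsub>H v\<^esub> h) = a v g \<otimes>\<^bsub>H v\<^esub> a v h" if g: "g \<in> carrier (H v)" and h: "h \<in> carrier (H v)" for g h
    proof -
      have p: "pprod M (map (syllable v) [k, l]) = syllable v (k \<otimes>\<^bsub>H v\<^esub> l)"
        if "k \<in> carrier (H v)" "l \<in> carrier (H v)" for k l
        using reduced_form_syllables[OF v, of "[k, l]"] that by (simp add: prod_eq)
      have "\<phi> (pprod M (map (syllable v) [g, h])) = pprod M (map \<phi> (map (syllable v) [g, h]))"
        using g h by (intro partial_hom_prod(2)[OF hom, symmetric] syllables_dom v) simp
      also have "\<dots> = pprod M (map (syllable v) [a v g, a v h])" using a(2)[OF v] g h by simp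
      finally show ?thesis using p g h a[OF v] by (simp add: syllable_inject)
    qed
    moreover have "bij_betw (a v) (carrier (H v)) (carrier (H v))"
      using endo_inj_surj[OF finite_groups[OF v] _ inj] a(1)[OF v] inj by (auto simp: bij_betw_def)
    ultimately show ?thesis
      using a(1)[OF v] v by (auto simp: auto_def Bij_def hom_def a_def)
  qed
  have mem: "a \<in> carrier Autos" using auto by (simp only: Autos_mem) (simp add: a_def)
  have "\<phi> w = letterwise a w" if "w \<in> pcarrier M" for w
  proof (rule hom_eq_if_eq_on_letters[OF hom letterwise_hom[OF auto] _ that])
    fix x assume "x \<in> pcarrier M" "length x \<le> 1"
    then show "\<phi> x = letterwise a x"
    proof (cases rule: carrier_syllable)
      case 1
      then show ?thesis using aut_Nil[OF \<phi>] \<open>x \<in> pcarrier M\<close> by (simp add: letterwise_def)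
    next
      case (2 v g)
      then have "x = syllable v g" by (simp add: syllable_def)
      then show ?thesis using a(2) letterwise_syllable auto 2 by simp
    qed
  qed
  then have "\<phi> = letterwise a"
    using \<phi> by (intro extensionalityI[of _ "pcarrier M"]) (auto simp: Bij_def letterwise_def)
  with mem show thesis by (rule that)
qed

lemma kernel_vertex_map:
  "kernel (partial_AutGroup M) (graph_AutGroup V E) vertex_map = letterwise ` carrier Autos"
proof -
  have one: "\<one>\<^bsub>graph_AutGroup V E\<^esub> = (\<lambda>v\<in>V. v)" by (simp add: graph_AutGroup_def BijGroup_def)
  have car: "carrier (partial_AutGroup M) = M.units" by (simp add: partial_AutGroup_def)
  show ?thesis
  proof
    show "kernel (partial_AutGroup M) (graph_AutGroup V E) vertex_map \<subseteq> letterwise ` carrier Autos"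
    proof
      fix \<phi> assume "\<phi> \<in> kernel (partial_AutGroup M) (graph_AutGroup V E) vertex_map"
      then have "\<phi> \<in> M.units" "vertex_map \<phi> = (\<lambda>v\<in>V. v)" by (simp_all add: kernel_def one car)
      then obtain a where "a \<in> carrier Autos" "\<phi> = letterwise a"
        using fixing_vertices_letterwise[of \<phi>] by auto
      then show "\<phi> \<in> letterwise ` carrier Autos" by simp
    qed
  next
    show "letterwise ` carrier Autos \<subseteq> kernel (partial_AutGroup M) (graph_AutGroup V E) vertex_map"
    proof
      fix \<phi> assume "\<phi> \<in> letterwise ` carrier Autos"
      then obtain a where a: "a \<in> carrier Autos" and \<phi>: "\<phi> = letterwise a" by blast
      then have u: "\<phi> \<in> M.units" using group_hom.hom_closed[OF group_hom_letterwise] car by blast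
      have "vertex_map \<phi> v = v" if v: "v \<in> V" for v
      proof -
        obtain g where g: "g \<in> carrier (H v)" "g \<noteq> \<one>\<^bsub>H v\<^esub>" using nontrivial_element[OF v] by blast
        show ?thesis
          using letter_carrier[OF v g] by (intro vertex_map_eqI[OF u v g]) (simp add: \<phi> letterwise_def)
      qed
      then have "vertex_map \<phi> = (\<lambda>v\<in>V. v)" by (auto simp: fun_eq_iff) (simp add: vertex_map_def)
      then show "\<phi> \<in> kernel (partial_AutGroup M) (graph_AutGroup V E) vertex_map"
        using u by (simp add: kernel_def one car)
    qed
  qed
qed

end

section \<open>The exact sequence\<close>

theorem theorem4p4:
  fixes V :: "'v set" and E :: "'v set set" and H :: "'v \<Rightarrow> 'h monoid"
  assumes "simple_graph V E"
    and "\<And>v. v \<in> V \<Longrightarrow> group (H v)"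
    and "\<And>v. v \<in> V \<Longrightarrow> finite (carrier (H v))"
    and "\<And>v. v \<in> V \<Longrightarrow> carrier (H v) \<noteq> {\<one>\<^bsub>H v\<^esub>}"
  defines "P \<equiv> product_group V (\<lambda>v. AutoGroup (H v))"
    and "A \<equiv> partial_AutGroup (graph_partial_group V E H)"
    and "B \<equiv> graph_AutGroup V E"
  shows "\<exists>\<alpha> \<beta>. group_hom P A \<alpha> \<and> group_hom A B \<beta> \<and>
           kernel P A \<alpha> = {\<one>\<^bsub>P\<^esub>} \<and> kernel A B \<beta> = \<alpha> ` carrier P"
proof -
  interpret graph_of_vertex_groups V E H by (rule graph_of_vertex_groups.intro) (fact assms(1-4))+
  show ?thesis
    unfolding P_def A_def B_def
    by (intro exI conjI) (rule group_hom_letterwise group_hom_vertex_map kernel_letterwise kernel_vertex_map)+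
qed

end
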